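(* Let $X$ be a compact metric space, let $\mathcal{L}$ be a transfer operator on $C^0(X,\mathbb{C})$, and let $\mu\in\mathcal{M}$ be such that $\mathcal{L}^*\mu=\mu$. Let $\varphi\in L_\infty$ be a real function. Define, for each natural number $n\ge 1$ and each $x \in X$, $$\varphi_n(x):=\max\{\varphi(x),\ (\varphi+\mathcal{L}\varphi)(x),\ \ldots,\ (\varphi+\mathcal{L}\varphi+\cdots+\mathcal{L}^{n-1}\varphi)(x)\},$$ $$E(\varphi):=\{x\in X : \sup_{n\ge 1}\varphi_n(x)>0\}.$$ Then $$\int_{E(\varphi)}\varphi\,d\mu\ \ge\ 0.$$
   Context: $X$ is a compact metric space, $\mathcal{A}$ its Borel sigma-algebra, $\mathcal{M}$ the set of all probability measures on $(X,\mathcal{A})$, and $C^0(X,\mathbb{C})$ the space of continuous functions $X\to\mathbb{C}$ with the supremum norm. A transfer operator is a linear operator $\mathcal{L}:C^0(X,\mathbb{C})\to C^0(X,\mathbb{C})$ such that: (1) $\mathcal{L}\varphi$ is real and non-negative whenever $\varphi$ is real and non-negative; (2) $\max_{x\in X}|(\mathcal{L}\varphi)(x)|\le\max_{x\in X}|\varphi(x)|$ for all $\varphi\in C^0(X,\mathbb{C})$, and $\mathcal{L}1=1$. Its dual transfer operator $\mathcal{L}^*:\mathcal{M}\to\mathcal{M}$ is the unique map with $\int\varphi\,d(\mathcal{L}^*\mu)=\int\mathcal{L}\varphi\,d\mu$ for all $\varphi\in C^0(X,\mathbb{C})$ and $\mu\in\mathcal{M}$. For each $x\in X$, $P(x,\cdot)\in\mathcal{M}$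 denotes the unique probability measure with $(\mathcal{L}\varphi)(x)=\int\varphi(y)\,P(x,dy)$ for all $\varphi\in C^0(X,\mathbb{C})$. $L_\infty$ denotes the set of bounded functions $\varphi:X\to\mathbb{C}$ such that for every $\mu\in\mathcal{M}$ there is a (Borel) measurable function $\varphi_\mu$ that coincides with $\varphi$ $\mu$-a.e.; one puts $\int\varphi\,d\mu:=\int\varphi_\mu\,d\mu$. The operator $\mathcal{L}$ is extended to $L_\infty$ by $(\mathcal{L}\varphi)(x):=\int\varphi(y)\,P(x,dy)$ for all $x\in X$, $\varphi\in L_\infty$; it maps $L_\infty$ to itself. $\mathcal{L}^j$ is the $j$-th iterate of this extended operator ($\mathcal{L}^0$ is the identity). For a set $E$, $\int_E\varphi\,d\mu$ means $\int\chi_E\varphi\,d\mu$, where $\chi_E$ is the characteristic function of $E$. *)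

theory Defs
  imports "HOL-Probability.Probability"
begin

text \<open>The compact metric space is the whole type \<open>'a\<close>; compactness of \<open>UNIV\<close> is a hypothesis of
  the theorem. Functions in \<open>C\<^sup>0(X, \<complex>)\<close> are those with \<open>continuous_on UNIV\<close>; an operator on
  \<open>C\<^sup>0(X, \<complex>)\<close> is represented by a HOL function whose values at discontinuous arguments are
  irrelevant.\<close>

definition C0 :: "('a::topological_space \<Rightarrow> complex) set" where
  "C0 = {\<phi>. continuous_on UNIV \<phi>}"

definition prob_measures :: "'a::topological_space measure set" where
  "prob_measures = {\<mu>. prob_space \<mu> \<and> sets \<mu> = sets borel}"

text \<open>On a compact space the suprema in the contraction condition are attained, i.e. they are the
  maxima, and both are real suprema of nonempty bounded sets.\<close>

definition transfer_operator ::
    "(('a::metric_space \<Rightarrow> complex) \<Rightarrow> ('a \<Rightarrow> complex)) \<Rightarrow> bool" where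
  "transfer_operator L \<longleftrightarrow>
     (\<forall>\<phi>\<in>C0. L \<phi> \<in> C0) \<and>
     (\<forall>\<phi>\<in>C0. \<forall>\<psi>\<in>C0. L (\<lambda>x. \<phi> x + \<psi> x) = (\<lambda>x. L \<phi> x + L \<psi> x)) \<and>
     (\<forall>c. \<forall>\<phi>\<in>C0. L (\<lambda>x. c * \<phi> x) = (\<lambda>x. c * L \<phi> x)) \<and>
     (\<forall>\<phi>\<in>C0. (\<forall>x. \<phi> x \<in> \<real>\<^sub>\<ge>\<^sub>0) \<longrightarrow> (\<forall>x. L \<phi> x \<in> \<real>\<^sub>\<ge>\<^sub>0)) \<and>
     (\<forall>\<phi>\<in>C0. (SUP x. cmod (L \<phi> x)) \<le> (SUP x. cmod (\<phi> x))) \<and>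
     L (\<lambda>x. 1) = (\<lambda>x. 1)"

text \<open>For a transfer operator on a compact space, existence and uniqueness of the measures selected
  by \<open>THE\<close> in the next two definitions is the Riesz representation theorem.\<close>

definition dual_transfer ::
    "(('a::metric_space \<Rightarrow> complex) \<Rightarrow> ('a \<Rightarrow> complex)) \<Rightarrow> 'a measure \<Rightarrow> 'a measure" where
  "dual_transfer L \<mu> =
     (THE \<nu>. \<nu> \<in> prob_measures \<and> (\<forall>\<phi>\<in>C0. integral\<^sup>L \<nu> \<phi> = integral\<^sup>L \<mu> (L \<phi>)))"

definition transition_prob ::
    "(('a::metric_space \<Rightarrow> complex) \<Rightarrow> ('a \<Rightarrow> complex)) \<Rightarrow> 'a \<Rightarrow> 'a measure" where
  "transition_prob L x =
     (THE P. P \<in> prob_measures \<and> (\<forall>\<phi>\<in>C0. L \<phi> x = integral\<^sup>L P \<phi>))"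

definition measurable_version ::
    "'a::topological_space measure \<Rightarrow> ('a \<Rightarrow> complex) \<Rightarrow> ('a \<Rightarrow> complex) \<Rightarrow> bool" where
  "measurable_version \<mu> \<phi> g \<longleftrightarrow> g \<in> borel_measurable borel \<and> (AE x in \<mu>. g x = \<phi> x)"

definition Linf :: "('a::topological_space \<Rightarrow> complex) set" where
  "Linf = {\<phi>. bounded (range \<phi>) \<and> (\<forall>\<mu>\<in>prob_measures. \<exists>g. measurable_version \<mu> \<phi> g)}"

text \<open>The value does not depend on the version chosen by \<open>SOME\<close>, since any two versions agree
  \<open>\<mu>\<close>-almost everywhere.\<close>

definition integral_Linf ::
    "'a::topological_space measure \<Rightarrow> ('a \<Rightarrow> complex) \<Rightarrow> complex" where
  "integral_Linf \<mu> \<phi> = integral\<^sup>L \<mu> (SOME g. measurable_version \<mu> \<phi> g)"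

definition set_integral_Linf ::
    "'a::topological_space measure \<Rightarrow> 'a set \<Rightarrow> ('a \<Rightarrow> complex) \<Rightarrow> complex" where
  "set_integral_Linf \<mu> E \<phi> = integral_Linf \<mu> (\<lambda>x. indicator E x * \<phi> x)"

definition ext_transfer ::
    "(('a::metric_space \<Rightarrow> complex) \<Rightarrow> ('a \<Rightarrow> complex)) \<Rightarrow> ('a \<Rightarrow> complex) \<Rightarrow> ('a \<Rightarrow> complex)" where
  "ext_transfer L \<phi> = (\<lambda>x. integral_Linf (transition_prob L x) \<phi>)"

text \<open>For real \<open>\<phi>\<close> the partial sums are real complex numbers; \<open>Re\<close> only turns them into elements
  of the ordered type \<open>real\<close>. Meaningful for \<open>n \<ge> 1\<close> only.\<close>

definition max_partial_sum ::
    "(('a::metric_space \<Rightarrow> complex) \<Rightarrow> ('a \<Rightarrow> complex)) \<Rightarrow> ('a \<Rightarrow> complex) \<Rightarrow> nat \<Rightarrow> 'a \<Rightarrow> real" where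
  "max_partial_sum L \<phi> n x =
     Max ((\<lambda>k. Re (\<Sum>j<k. (ext_transfer L ^^ j) \<phi> x)) ` {1..n})"

text \<open>The supremum is taken in the extended reals because it may be infinite.\<close>

definition pos_set ::
    "(('a::metric_space \<Rightarrow> complex) \<Rightarrow> ('a \<Rightarrow> complex)) \<Rightarrow> ('a \<Rightarrow> complex) \<Rightarrow> 'a set" where
  "pos_set L \<phi> = {x. (SUP n\<in>{1..}. ereal (max_partial_sum L \<phi> n x)) > 0}"

end

theory Submission
  imports Defs
begin

text \<open>
  The statement is Hopf's maximal ergodic theorem for the Markov chain with transition probabilities
  \<open>P(x, \<cdot>)\<close>. Garsia's argument proves it. Let \<open>M\<^sub>n\<close> be the maximum of \<open>0\<close> and of the first \<open>n\<close>
  partial sums of \<open>\<phi> + L \<phi> + L\<^sup>2 \<phi> + \<dots>\<close>. Each nonempty partial sum is \<open>\<phi>\<close> plus \<open>L\<close> of a shorter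
  one, hence at most \<open>\<phi> + L M\<^sub>n\<close>. So \<open>\<phi> \<ge> M\<^sub>n - L M\<^sub>n\<close> where \<open>M\<^sub>n > 0\<close>, and elsewhere
  \<open>M\<^sub>n - L M\<^sub>n \<le> 0\<close>. Integration over the space gives \<open>\<integral>\<close> of \<open>\<phi>\<close> over \<open>{M\<^sub>n > 0}\<close> at least
  \<open>\<integral>M\<^sub>n d\<mu> - \<integral>L M\<^sub>n d\<mu> = 0\<close>, and \<open>n\<close> tends to infinity. This is done in
  \<open>max_sum_minus_average_le\<close> and \<open>maximal_ergodic_inequality\<close>.

  Most of the work is to justify that \<open>L\<close> acts on \<open>Linf\<close> as a positive linear operator that preserves
  the integral for \<open>\<mu>\<close>. The transition probabilities and the dual operator are given by definite
  descriptions, so nothing is known of them before the Riesz representation theorem is available.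
  It is proved here for compact metric spaces (\<open>integral_representing_measure\<close> and
  \<open>Riesz_representation_complex\<close>). A normalised positive functional defines a set function on open
  sets by the supremum over the continuous functions below the indicator; Dini's theorem makes it
  countably subadditive, and Caratheodory's construction yields a Borel measure.

  It follows that the transition probabilities form a measurable kernel, and that a fixed point of
  the dual operator is a stationary distribution of the kernel (\<open>dual_transfer_fixpoint_bind\<close>). The real
  members of \<open>Linf\<close> are the bounded functions that are measurable for the completion of every Borel
  probability measure. They are preserved by the kernel because a Borel null set for
  \<open>\<nu> \<bind> K\<close> is a null set for almost all \<open>K x\<close> (\<open>kernel_borel_version\<close>).
\<close>

section \<open>Approximating open sets by continuous functions\<close>

text \<open>The bumps are truncated multiples of the distance to the complement. Through them the measure
  of an open set is determined by the integrals of continuous functions.\<close>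

lemma open_bump_sequence:
  fixes U :: "'a::metric_space set"
  assumes "open U"
  obtains g :: "nat \<Rightarrow> 'a \<Rightarrow> real" where
    "\<And>k. continuous_on UNIV (g k)" "\<And>k x. 0 \<le> g k x" "\<And>k x. g k x \<le> indicator U x"
    "\<And>j k x. j \<le> k \<Longrightarrow> g j x \<le> g k x" "\<And>x. x \<in> U \<Longrightarrow> \<exists>k. g k x = 1"
proof (cases "U = UNIV")
  case True
  show ?thesis
    by (rule that[of "\<lambda>_ _. 1"]) (auto simp: True)
next
  case False
  define g where "g k x = min 1 (real k * infdist x (- U))" for k x
  have "closed (- U)" "- U \<noteq> {}"
    using assms False by auto
  then have pos: "0 < infdist x (- U)" if "x \<in> U" for x
    using that in_closed_iff_infdist_zero[of "- U" x] infdist_nonneg[of x "- U"]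
    by (auto simp: less_le)
  show ?thesis
  proof (rule that[of g])
    show "continuous_on UNIV (g k)" for k
      unfolding g_def by (intro continuous_intros)
    show "0 \<le> g k x" for k x
      by (simp add: g_def infdist_nonneg)
    show "g k x \<le> indicator U x" for k x
      by (cases "x \<in> U") (auto simp: g_def)
    show "g j x \<le> g k x" if "j \<le> k" for j k x
      unfolding g_def using that
      by (intro min.mono mult_right_mono) (auto simp: infdist_nonneg)
    show "\<exists>k. g k x = 1" if x: "x \<in> U" for x
    proof -
      obtain k :: nat where "1 < real k * infdist x (- U)"
        using reals_Archimedean3[OF pos[OF x], rule_format, of 1] by blast
      then show ?thesis
        by (intro exI[of _ k]) (simp add: g_def)
    qed
  qed
qed

lemma bounded_continuous_compact_UNIV:
  fixes f :: "'a::metric_space \<Rightarrow> 'b::real_normed_vector"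
  assumes "compact (UNIV :: 'a set)" "continuous_on UNIV f"
  obtains B where "0 < B" "\<And>x. norm (f x) \<le> B"
  using compact_imp_bounded[OF compact_continuous_image[OF assms(2,1)]]
  unfolding bounded_pos by auto

text \<open>The part of Dini's theorem that turns pointwise smallness of a decreasing sequence into uniform
  smallness: the open sets \<open>{F n < e}\<close> increase and cover the compact space.\<close>

lemma Dini_decreasing:
  fixes F :: "nat \<Rightarrow> 'a::metric_space \<Rightarrow> real"
  assumes "compact (UNIV :: 'a set)" "\<And>n. continuous_on UNIV (F n)"
    and "\<And>m n x. m \<le> n \<Longrightarrow> F n x \<le> F m x" "\<And>x. \<exists>n. F n x < e"
  shows "\<exists>n. \<forall>x. F n x < e"
proof -
  have "open {x. F n x < e}" for n
    by (intro open_Collect_less assms continuous_intros)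
  moreover have "UNIV \<subseteq> (\<Union>n\<in>UNIV. {x. F n x < e})"
    using assms(4) by auto
  ultimately obtain C where C: "finite C" "UNIV \<subseteq> (\<Union>n\<in>C. {x. F n x < e})"
    using compactE_image[OF assms(1), of UNIV "\<lambda>n. {x. F n x < e}"] by metis
  have "F (Max C) x < e" for x
  proof -
    obtain n where "n \<in> C" "F n x < e"
      using C by blast
    then show ?thesis
      using assms(3)[of n "Max C" x] C(1) by auto
  qed
  then show ?thesis by blast
qed

lemma emeasure_open_eq_SUP_bump:
  fixes g :: "nat \<Rightarrow> 'a::metric_space \<Rightarrow> real"
  assumes \<nu>: "prob_space \<nu>" "sets \<nu> = sets borel"
    and g: "\<And>k. continuous_on UNIV (g k)" "\<And>k x. 0 \<le> g k x" "\<And>k x. g k x \<le> indicator U x"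
    "\<And>j k x. j \<le> k \<Longrightarrow> g j x \<le> g k x" "\<And>x. x \<in> U \<Longrightarrow> \<exists>k. g k x = 1"
    and "open U"
  shows "emeasure \<nu> U = (SUP k. ennreal (integral\<^sup>L \<nu> (g k)))"
proof -
  interpret prob_space \<nu> by fact
  have meas[measurable]: "g k \<in> borel_measurable \<nu>" for k
    using g(1) borel_measurable_continuous_onI measurable_cong_sets[OF \<nu>(2) refl] by metis
  have [measurable]: "U \<in> sets \<nu>"
    using \<nu>(2) \<open>open U\<close> by simp
  have sup: "(SUP k. ennreal (g k x)) = indicator U x" for x
  proof (cases "x \<in> U")
    case True
    then obtain k where k: "g k x = 1"
      using g(5) by blast
    have "(SUP k. ennreal (g k x)) = 1"
    proof (rule antisym)
      show "(SUP k. ennreal (g k x)) \<le> 1"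
        using g(3)[of _ x] True by (intro SUP_least) simp
      show "1 \<le> (SUP k. ennreal (g k x))"
        by (rule SUP_upper2[of k]) (simp_all add: k)
    qed
    then show ?thesis using True by simp
  next
    case False
    then have "g k x = 0" for k
      using g(2,3)[of k x] by simp
    then show ?thesis using False by simp
  qed
  have int: "integrable \<nu> (g k)" for k
  proof (rule integrable_const_bound[of _ 1])
    show "AE x in \<nu>. norm (g k x) \<le> 1"
      using g(2,3)[of k] indicator_le_1[of U, where 'a=real] by (intro AE_I2) (metis abs_of_nonneg order_trans real_norm_def)
  qed simp
  have "emeasure \<nu> U = (\<integral>\<^sup>+x. (SUP k. ennreal (g k x)) \<partial>\<nu>)"
    by (simp add: sup)
  also have "\<dots> = (SUP k. \<integral>\<^sup>+x. ennreal (g k x) \<partial>\<nu>)"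
    by (intro nn_integral_monotone_convergence_SUP)
       (auto simp: incseq_def le_fun_def intro!: ennreal_leI g(4))
  also have "\<dots> = (SUP k. ennreal (integral\<^sup>L \<nu> (g k)))"
    using int g(2) by (simp add: nn_integral_eq_integral)
  finally show ?thesis .
qed

text \<open>The open sets generate the Borel sets and are closed under intersection, so it suffices to
  compare the two measures on them, by bumps.\<close>

lemma prob_borel_eqI_continuous:
  fixes \<nu>1 \<nu>2 :: "'a::metric_space measure"
  assumes "\<nu>1 \<in> prob_measures" "\<nu>2 \<in> prob_measures"
    and "\<And>f :: 'a \<Rightarrow> real. continuous_on UNIV f \<Longrightarrow> integral\<^sup>L \<nu>1 f = integral\<^sup>L \<nu>2 f"
  shows "\<nu>1 = \<nu>2"
proof (rule measure_eqI_generator_eq[where \<Omega> = UNIV and E = "{S. open S}" and A = "\<lambda>_. UNIV"])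
  have *: "prob_space \<nu>1" "sets \<nu>1 = sets borel" "prob_space \<nu>2" "sets \<nu>2 = sets borel"
    using assms(1,2) by (auto simp: prob_measures_def)
  show "sets \<nu>1 = sigma_sets UNIV {S. open S}" "sets \<nu>2 = sigma_sets UNIV {S. open S}"
    using * by (auto simp: sets_borel)
  show "emeasure \<nu>1 U = emeasure \<nu>2 U" if "U \<in> {S. open S}" for U
  proof -
    have U: "open U" using that by simp
    obtain g :: "nat \<Rightarrow> 'a \<Rightarrow> real" where g:
      "\<And>k. continuous_on UNIV (g k)" "\<And>k x. 0 \<le> g k x" "\<And>k x. g k x \<le> indicator U x"
      "\<And>j k x. j \<le> k \<Longrightarrow> g j x \<le> g k x" "\<And>x. x \<in> U \<Longrightarrow> \<exists>k. g k x = 1"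
      by (rule open_bump_sequence[OF U]) blast
    show ?thesis
      using emeasure_open_eq_SUP_bump[OF *(1,2) g U] emeasure_open_eq_SUP_bump[OF *(3,4) g U]
      by (simp add: assms(3)[OF g(1)])
  qed
  interpret prob_space \<nu>1 by fact
  show "emeasure \<nu>1 UNIV \<noteq> \<infinity>" by simp
qed (auto simp: Int_stable_def)

section \<open>The Riesz representation theorem on a compact metric space\<close>

lemma sum_indicator_levels_le:
  fixes t :: real
  assumes "0 \<le> t"
  shows "(\<Sum>k<n. if real k < t then 1 else 0) \<le> t + 1"
proof -
  have "(\<Sum>k<n. if real k < t then 1 else 0) \<le> min (real n) (t + 1)"
    using assms by (induction n) auto
  then show ?thesis by simp
qed

lemma sum_layers_eq:
  fixes t :: real
  assumes "0 \<le> t"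
  shows "(\<Sum>k<n. min 1 (max 0 (t - real k))) = min (real n) t"
  using assms by (induction n) auto

locale normalised_positive_functional =
  fixes \<Lambda> :: "('a::metric_space \<Rightarrow> real) \<Rightarrow> real"
  assumes compact_UNIV: "compact (UNIV :: 'a set)"
    and add: "continuous_on UNIV f \<Longrightarrow> continuous_on UNIV g \<Longrightarrow> \<Lambda> (\<lambda>x. f x + g x) = \<Lambda> f + \<Lambda> g"
    and scale: "continuous_on UNIV f \<Longrightarrow> \<Lambda> (\<lambda>x. c * f x) = c * \<Lambda> f"
    and nonneg: "continuous_on UNIV f \<Longrightarrow> (\<And>x. 0 \<le> f x) \<Longrightarrow> 0 \<le> \<Lambda> f"
    and one: "\<Lambda> (\<lambda>_. 1) = 1"
begin

lemma const: "\<Lambda> (\<lambda>_. c) = c"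
  using scale[of "\<lambda>_. 1" c] one by simp

lemma diff:
  assumes "continuous_on UNIV f" "continuous_on UNIV g"
  shows "\<Lambda> (\<lambda>x. f x - g x) = \<Lambda> f - \<Lambda> g"
  using add[OF assms(1), of "\<lambda>x. - 1 * g x"] scale[OF assms(2), of "- 1"] assms(2)
  by (simp add: continuous_on_minus)

lemma mono:
  assumes "continuous_on UNIV f" "continuous_on UNIV g" "\<And>x. f x \<le> g x"
  shows "\<Lambda> f \<le> \<Lambda> g"
  using nonneg[of "\<lambda>x. g x - f x"] diff[OF assms(2,1)] assms
  by (simp add: continuous_on_diff)

lemma sum:
  assumes "finite I" "\<And>i. i \<in> I \<Longrightarrow> continuous_on UNIV (f i)"
  shows "\<Lambda> (\<lambda>x. \<Sum>i\<in>I. f i x) = (\<Sum>i\<in>I. \<Lambda> (f i))"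
  using assms by (induction I) (simp_all add: const add continuous_on_sum)

definition subordinate :: "'a set \<Rightarrow> ('a \<Rightarrow> real) set" where
  "subordinate U = {f. continuous_on UNIV f \<and> (\<forall>x. 0 \<le> f x \<and> f x \<le> indicator U x)}"

lemma zero_subordinate: "(\<lambda>_. 0) \<in> subordinate U"
  by (simp add: subordinate_def)

text \<open>No other value on open sets is possible for a representing measure: bumps increase to the
  indicator of \<open>U\<close>, so by monotone convergence the measure of \<open>U\<close> is this supremum.\<close>

definition content :: "'a set \<Rightarrow> ennreal" where
  "content U = (SUP f\<in>subordinate U. ennreal (\<Lambda> f))"

definition outer :: "'a set \<Rightarrow> ennreal" where
  "outer A = (INF U\<in>{U. open U \<and> A \<subseteq> U}. content U)"

lemma content_upper: "f \<in> subordinate U \<Longrightarrow> ennreal (\<Lambda> f) \<le> content U"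
  unfolding content_def by (rule SUP_upper)

lemma content_mono:
  assumes "U \<subseteq> V"
  shows "content U \<le> content V"
  unfolding content_def
proof (rule SUP_subset_mono)
  have "indicator U x \<le> (indicator V x :: real)" for x
    using assms by (auto simp: indicator_def)
  then show "subordinate U \<subseteq> subordinate V"
    unfolding subordinate_def by (blast intro: order_trans)
qed simp

lemma content_empty: "content {} = 0"
proof -
  have "subordinate {} = {\<lambda>_. 0}"
    unfolding subordinate_def by (auto simp: fun_eq_iff intro: antisym)
  then show ?thesis
    by (simp add: content_def const)
qed

lemma content_UNIV: "content UNIV = 1"
proof (rule antisym)
  show "content UNIV \<le> 1"
    unfolding content_def
  proof (rule SUP_least)
    fix f assume "f \<in> subordinate UNIV"
    then have "\<Lambda> f \<le> \<Lambda> (\<lambda>_. 1)"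
      by (intro mono) (auto simp: subordinate_def)
    then show "ennreal (\<Lambda> f) \<le> 1"
      by (simp add: one)
  qed
  show "1 \<le> content UNIV"
    using content_upper[of "\<lambda>_. 1" UNIV] by (simp add: one subordinate_def)
qed

text \<open>A function subordinate to the union is, up to a uniformly small error, dominated by finitely
  many bumps of the individual sets: its difference to the sum of the first \<open>k\<close> bumps decreases
  with \<open>k\<close> and is eventually at most \<open>0\<close> at each point, so Dini's theorem applies.\<close>

lemma content_UN_le:
  assumes "\<And>i::nat. open (U i)"
  shows "content (\<Union>i. U i) \<le> (\<Sum>i. content (U i))"
  unfolding content_def[of "\<Union>i. U i"]
proof (rule SUP_least)
  fix f assume "f \<in> subordinate (\<Union>i. U i)"
  then have f: "continuous_on UNIV f" "\<And>x. 0 \<le> f x" "\<And>x. f x \<le> indicator (\<Union>i. U i) x"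
    by (auto simp: subordinate_def)
  have "\<exists>g :: nat \<Rightarrow> 'a \<Rightarrow> real. (\<forall>k. g k \<in> subordinate (U i)) \<and>
      (\<forall>j k x. j \<le> k \<longrightarrow> g j x \<le> g k x) \<and> (\<forall>x\<in>U i. \<exists>k. g k x = 1)" for i
    unfolding subordinate_def mem_Collect_eq by (rule open_bump_sequence[OF assms[of i]]) blast
  then obtain g :: "nat \<Rightarrow> nat \<Rightarrow> 'a \<Rightarrow> real" where
    g_sub: "\<And>i k. g i k \<in> subordinate (U i)" and
    g_mono: "\<And>i j k x. j \<le> k \<Longrightarrow> g i j x \<le> g i k x" and
    g_one: "\<And>i x. x \<in> U i \<Longrightarrow> \<exists>k. g i k x = 1"
    by metis
  have g_cont: "continuous_on UNIV (g i k)" and g_nonneg: "0 \<le> g i k x" for i k x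
    using g_sub[of i k] by (auto simp: subordinate_def)
  define h where "h k x = (\<Sum>i\<le>k. g i k x)" for k x
  have h_cont: "continuous_on UNIV (h k)" for k
    unfolding h_def by (intro continuous_intros g_cont)
  have h_mono: "h j x \<le> h k x" if "j \<le> k" for j k x
  proof -
    have "h j x \<le> (\<Sum>i\<le>j. g i k x)"
      unfolding h_def by (intro sum_mono g_mono that)
    also have "\<dots> \<le> h k x"
      unfolding h_def using that by (intro sum_mono2) (auto simp: g_nonneg)
    finally show ?thesis .
  qed
  show "ennreal (\<Lambda> f) \<le> (\<Sum>i. content (U i))"
  proof (rule ennreal_le_epsilon)
    fix e :: real
    assume "0 < e"
    have "\<exists>k. \<forall>x. f x - h k x < e"
    proof (rule Dini_decreasing[OF compact_UNIV])
      show "continuous_on UNIV (\<lambda>x. f x - h n x)" for n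
        by (intro continuous_intros f(1) h_cont)
      show "f x - h n x \<le> f x - h m x" if "m \<le> n" for m n x
        using h_mono[OF that, of x] by simp
      show "\<exists>n. f x - h n x < e" for x
      proof (cases "x \<in> (\<Union>i. U i)")
        case True
        then obtain i k where "g i k x = 1"
          using g_one by blast
        then have "1 \<le> g i (max i k) x"
          using g_mono[of k "max i k" i x] by simp
        also have "\<dots> \<le> h (max i k) x"
          unfolding h_def by (rule member_le_sum) (auto simp: g_nonneg)
        finally have "f x - h (max i k) x \<le> 0"
          using f(3)[of x] True by simp
        then show ?thesis
          using \<open>0 < e\<close> by (intro exI[of _ "max i k"]) simp
      next
        case False
        then have "f x = 0"
          using f(2,3)[of x] by simp
        moreover have "0 \<le> h 0 x"
          unfolding h_def by (simp add: g_nonneg)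
        ultimately show ?thesis
          using \<open>0 < e\<close> by (intro exI[of _ 0]) simp
      qed
    qed
    then obtain k where k: "\<And>x. f x - h k x < e"
      by blast
    have "\<Lambda> f \<le> \<Lambda> (\<lambda>x. h k x + e)"
    proof (rule mono)
      show "f x \<le> h k x + e" for x
        using k[of x] by simp
    qed (intro continuous_intros f(1) h_cont)+
    also have "\<dots> = (\<Sum>i\<le>k. \<Lambda> (g i k)) + e"
      by (simp add: add h_cont const) (simp add: h_def[abs_def] sum g_cont)
    finally have "ennreal (\<Lambda> f) \<le> ennreal ((\<Sum>i\<le>k. \<Lambda> (g i k)) + e)"
      by (rule ennreal_leI)
    also have "\<dots> = (\<Sum>i\<le>k. ennreal (\<Lambda> (g i k))) + ennreal e"
      using \<open>0 < e\<close> by (simp add: sum_ennreal ennreal_plus sum_nonneg nonneg g_cont g_nonneg)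
    also have "\<dots> \<le> (\<Sum>i\<le>k. content (U i)) + ennreal e"
      by (intro add_mono sum_mono content_upper g_sub order_refl)
    also have "\<dots> \<le> (\<Sum>i. content (U i)) + ennreal e"
      by (intro add_mono sum_le_suminf order_refl) auto
    finally show "ennreal (\<Lambda> f) \<le> (\<Sum>i. content (U i)) + ennreal e" .
  qed
qed

lemma outer_open: "open U \<Longrightarrow> outer U = content U"
  unfolding outer_def
  by (intro antisym INF_lower INF_greatest) (auto intro: content_mono)

lemma outer_le_content: "open U \<Longrightarrow> A \<subseteq> U \<Longrightarrow> outer A \<le> content U"
  unfolding outer_def by (rule INF_lower) simp

lemma outer_less_iff: "outer A < c \<longleftrightarrow> (\<exists>U. open U \<and> A \<subseteq> U \<and> content U < c)"
  by (auto simp: outer_def INF_less_iff)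

lemma outer_measure_space_outer: "outer_measure_space (Pow UNIV) outer"
  unfolding outer_measure_space_def
proof (intro conjI)
  show "positive (Pow UNIV) outer"
    by (simp add: positive_def outer_open content_empty)
  show "increasing (Pow UNIV) outer"
    unfolding increasing_def outer_def by (intro ballI impI INF_superset_mono) auto
  show "countably_subadditive (Pow UNIV) outer"
    unfolding countably_subadditive_def
  proof (intro allI impI)
    fix A :: "nat \<Rightarrow> 'a set"
    show "outer (\<Union>i. A i) \<le> (\<Sum>i. outer (A i))"
    proof (rule ennreal_le_epsilon)
      fix e :: real
      assume "0 < e" "(\<Sum>i. outer (A i)) < top"
      then have "outer (A n) < outer (A n) + e * (1/2)^Suc n" for n
        by (auto simp add: less_top dest!: ennreal_suminf_lessD)
      then have "\<exists>U. open U \<and> A n \<subseteq> U \<and> content U < outer (A n) + e * (1/2)^Suc n" for n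
        unfolding outer_less_iff by blast
      then obtain U where U: "\<And>n. open (U n)" "\<And>n. A n \<subseteq> U n"
          and less: "\<And>n. content (U n) < outer (A n) + e * (1/2)^Suc n"
        by metis
      have "outer (\<Union>i. A i) \<le> content (\<Union>i. U i)"
        using U by (intro outer_le_content) auto
      also have "\<dots> \<le> (\<Sum>i. content (U i))"
        by (rule content_UN_le[OF U(1)])
      also have "\<dots> \<le> (\<Sum>n. outer (A n) + e * (1/2) ^ Suc n)"
        by (intro suminf_le less_imp_le less) auto
      also have "\<dots> = (\<Sum>n. outer (A n)) + (\<Sum>n. ennreal e * ennreal ((1/2) ^ Suc n))"
        using \<open>0 < e\<close> by (subst suminf_add[symmetric])
          (auto simp del: ennreal_suminf_cmult simp add: ennreal_mult[symmetric])
      also have "\<dots> = (\<Sum>n. outer (A n)) + e"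
        unfolding ennreal_suminf_cmult
        by (subst suminf_ennreal_eq[OF zero_le_power power_half_series]) auto
      finally show "outer (\<Union>i. A i) \<le> (\<Sum>n. outer (A n)) + e" .
    qed
  qed
qed

text \<open>If \<open>f\<close> is subordinate to \<open>V \<inter> U\<close>, then \<open>V \<inter> {f < e}\<close> is an open neighbourhood of \<open>V - U\<close>
  on which the truncation \<open>max 0 (f - e)\<close> vanishes. So this truncation can be added to any function
  subordinate to that neighbourhood, and the sum is still subordinate to \<open>V\<close>.\<close>

lemma content_split_le:
  assumes "open U" "open V"
  shows "content (V \<inter> U) + outer (V - U) \<le> content V"
proof -
  have "ennreal (\<Lambda> f) + outer (V - U) \<le> content V" if "f \<in> subordinate (V \<inter> U)" for f
  proof (rule ennreal_le_epsilon)
    fix e :: real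
    assume "0 < e"
    have f: "continuous_on UNIV f" "\<And>x. 0 \<le> f x" "\<And>x. f x \<le> indicator (V \<inter> U) x"
      using that by (auto simp: subordinate_def)
    define W where "W = V \<inter> {x. f x < e}"
    have W: "open W"
      unfolding W_def using assms f(1) by (intro open_Int open_Collect_less continuous_intros)
    have "V - U \<subseteq> W"
    proof
      fix x assume "x \<in> V - U"
      then show "x \<in> W"
        using f(3)[of x] \<open>0 < e\<close> by (simp add: W_def)
    qed
    then have "ennreal (\<Lambda> f) + outer (V - U) \<le> ennreal (\<Lambda> f) + content W"
      using W by (intro add_left_mono outer_le_content)
    also have "\<dots> = (SUP g\<in>subordinate W. ennreal (\<Lambda> f) + ennreal (\<Lambda> g))"
      unfolding content_def using zero_subordinate by (intro ennreal_SUP_add_right) auto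
    also have "\<dots> \<le> content V + e"
    proof (rule SUP_least)
      fix g assume "g \<in> subordinate W"
      then have g: "continuous_on UNIV g" "\<And>x. 0 \<le> g x" "\<And>x. g x \<le> indicator W x"
        by (auto simp: subordinate_def)
      define s where "s x = max 0 (f x - e) + g x" for x
      have s: "s \<in> subordinate V"
        unfolding subordinate_def
      proof (intro CollectI conjI allI)
        show "continuous_on UNIV s"
          unfolding s_def by (intro continuous_intros f(1) g(1))
        show "0 \<le> s x" for x
          using g(2)[of x] by (simp add: s_def)
        show "s x \<le> indicator V x" for x
          using f(2,3)[of x] g(2,3)[of x] \<open>0 < e\<close>
          by (auto simp: s_def W_def indicator_def of_bool_def max_def split: if_splits)
      qed
      have "\<Lambda> f + \<Lambda> g = \<Lambda> (\<lambda>x. f x + g x)"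
        by (simp add: add f g)
      also have "\<dots> \<le> \<Lambda> (\<lambda>x. s x + e)"
        using s by (intro mono continuous_intros f(1) g(1)) (auto simp: s_def subordinate_def)
      also have "\<dots> = \<Lambda> s + e"
        using s by (simp add: add const subordinate_def)
      finally have "ennreal (\<Lambda> f + \<Lambda> g) \<le> ennreal (\<Lambda> s + e)"
        by (rule ennreal_leI)
      also have "\<dots> = ennreal (\<Lambda> s) + e"
        using s \<open>0 < e\<close> by (intro ennreal_plus nonneg) (auto simp: subordinate_def)
      also have "\<dots> \<le> content V + e"
        by (intro add_right_mono content_upper s)
      finally show "ennreal (\<Lambda> f) + ennreal (\<Lambda> g) \<le> content V + e"
        by (simp add: ennreal_plus nonneg f g)
    qed
    finally show "ennreal (\<Lambda> f) + outer (V - U) \<le> content V + e" .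
  qed
  then show ?thesis
    unfolding content_def[of "V \<inter> U"]
    using zero_subordinate by (subst ennreal_SUP_add_left[symmetric]) (auto intro!: SUP_least)
qed

text \<open>An arbitrary set has, by outer regularity, almost the outer measure of some open set around it,
  so splitting open sets is enough.\<close>

lemma open_in_lambda_system:
  assumes "open U"
  shows "U \<in> lambda_system UNIV (Pow UNIV) outer"
proof -
  have "outer (A \<inter> U) + outer (A - U) = outer A" for A
  proof (rule antisym)
    show "outer (A \<inter> U) + outer (A - U) \<le> outer A"
      unfolding outer_def[of A]
    proof (rule INF_greatest)
      fix V assume V: "V \<in> {V. open V \<and> A \<subseteq> V}"
      have inc: "outer B \<le> outer C" if "B \<subseteq> C" for B C
        using outer_measure_space_outer that by (auto simp: outer_measure_space_def increasing_def)
      have "outer (A \<inter> U) + outer (A - U) \<le> outer (V \<inter> U) + outer (V - U)"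
        using V by (intro add_mono inc) auto
      also have "\<dots> \<le> content V"
        using content_split_le[of U V] V assms by (simp add: outer_open open_Int)
      finally show "outer (A \<inter> U) + outer (A - U) \<le> content V" .
    qed
    have "subadditive (Pow UNIV) outer"
      using outer_measure_space_outer
      by (intro ring_of_sets.countably_subadditive_subadditive[OF ring_of_sets_Pow])
         (auto simp: outer_measure_space_def)
    from subadditiveD[OF this, of "A \<inter> U" "A - U"]
    show "outer A \<le> outer (A \<inter> U) + outer (A - U)"
      by (simp add: Int_Diff_disjoint Int_Diff_Un)
  qed
  then show ?thesis
    unfolding algebra.lambda_system_eq[OF algebra_Pow] by simp
qed

text \<open>Caratheodory's construction applies to the outer measure, and the splitting property of open
  sets shows that all Borel sets are measurable for it.\<close>

definition representing_measure :: "'a measure" where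
  "representing_measure = measure_of UNIV (sets borel) outer"

lemma sets_representing_measure: "sets representing_measure = sets borel"
  by (metis representing_measure_def sets.sets_measure_of_eq space_borel)

lemma emeasure_representing_measure:
  assumes "A \<in> sets borel"
  shows "emeasure representing_measure A = outer A"
proof -
  define N where "N = lambda_system UNIV (Pow UNIV) outer"
  have N: "measure_space UNIV N outer"
    unfolding N_def
    by (rule sigma_algebra.caratheodory_lemma[OF sigma_algebra_Pow outer_measure_space_outer])
  then have "sigma_algebra UNIV N"
    by (simp add: measure_space_def)
  moreover have "{S. open S} \<subseteq> N"
    unfolding N_def using open_in_lambda_system by auto
  ultimately have "sets borel \<subseteq> N"
    unfolding sets_borel by (rule sigma_algebra.sigma_sets_subset)
  moreover have "sigma_algebra UNIV (sets (borel :: 'a measure))"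
    using sets.sigma_algebra_axioms[of "borel :: 'a measure"] by simp
  ultimately have "measure_space UNIV (sets borel) outer"
    using measure_down[OF N] by blast
  then show ?thesis
    unfolding representing_measure_def using assms
    by (intro emeasure_measure_of_sigma) (auto simp: measure_space_def)
qed

lemma prob_space_representing_measure: "prob_space representing_measure"
proof (rule prob_spaceI)
  have "space representing_measure = UNIV"
    using sets_eq_imp_space_eq[OF sets_representing_measure] by simp
  then show "emeasure representing_measure (space representing_measure) = 1"
    by (simp add: emeasure_representing_measure outer_open content_UNIV)
qed

text \<open>Cut the graph of \<open>n * f\<close> into \<open>n\<close> layers of height \<open>1\<close>. The \<open>k\<close>-th layer is subordinate to
  \<open>{n * f > k}\<close>, so the functional does not exceed the measure of this set on it; and at each point
  the number of the sets to which the point belongs is at most \<open>n * f + 1\<close>.\<close>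

lemma functional_le_integral_aux:
  assumes f: "continuous_on UNIV f" "\<And>x. 0 \<le> f x" "\<And>x. f x \<le> 1" and "0 < n"
  shows "\<Lambda> f \<le> integral\<^sup>L representing_measure f + 1 / real n"
proof -
  interpret prob_space representing_measure
    by (rule prob_space_representing_measure)
  define layer where "layer k x = min 1 (max 0 (real n * f x - real k))" for k x
  define U where "U k = {x. real k < real n * f x}" for k
  have layer_cont: "continuous_on UNIV (layer k)" for k
    unfolding layer_def by (intro continuous_intros f(1))
  have U_open: "open (U k)" for k
    unfolding U_def by (intro open_Collect_less continuous_intros f(1))
  have [measurable]: "U k \<in> events" for k
    using U_open by (simp add: sets_representing_measure)
  have [measurable]: "f \<in> borel_measurable representing_measure"
    using f(1) borel_measurable_continuous_onI
      measurable_cong_sets[OF sets_representing_measure refl] by blast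
  have f_int: "integrable representing_measure f"
    using f(2,3) by (intro integrable_const_bound[of _ 1]) (auto simp: abs_of_nonneg)
  have layer_le: "\<Lambda> (layer k) \<le> measure representing_measure (U k)" for k
  proof -
    have "layer k \<in> subordinate (U k)"
      using layer_cont by (auto simp: subordinate_def layer_def U_def indicator_def)
    from content_upper[OF this] have "ennreal (\<Lambda> (layer k)) \<le> emeasure representing_measure (U k)"
      using U_open by (simp add: emeasure_representing_measure outer_open)
    then show ?thesis
      by (simp add: emeasure_eq_measure)
  qed
  have "real n * \<Lambda> f = \<Lambda> (\<lambda>x. \<Sum>k<n. layer k x)"
  proof -
    have "(\<Sum>k<n. layer k x) = real n * f x" for x
      using sum_layers_eq[of "real n * f x" n] f(2,3)[of x]
      by (simp add: layer_def mult_left_le)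
    then show ?thesis
      by (simp add: scale f(1))
  qed
  also have "\<dots> = (\<Sum>k<n. \<Lambda> (layer k))"
    by (intro sum layer_cont) auto
  also have "\<dots> \<le> (\<Sum>k<n. measure representing_measure (U k))"
    by (intro sum_mono layer_le)
  also have "\<dots> = (\<integral>x. (\<Sum>k<n. indicator (U k) x) \<partial>representing_measure)"
    by (subst Bochner_Integration.integral_sum) (auto simp: emeasure_eq_measure)
  also have "\<dots> \<le> (\<integral>x. real n * f x + 1 \<partial>representing_measure)"
  proof (rule integral_mono)
    show "(\<Sum>k<n. indicator (U k) x) \<le> real n * f x + 1" for x
      using sum_indicator_levels_le[of "real n * f x" n] f(2)[of x]
      unfolding U_def indicator_def of_bool_def mem_Collect_eq by simp
  qed (auto intro!: f_int simp: emeasure_eq_measure)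
  also have "\<dots> = real n * integral\<^sup>L representing_measure f + 1"
    using f_int by (simp add: prob_space)
  finally show ?thesis
    using \<open>0 < n\<close> by (simp add: field_simps)
qed

lemma functional_le_integral:
  assumes "continuous_on UNIV f" "\<And>x. 0 \<le> f x" "\<And>x. f x \<le> 1"
  shows "\<Lambda> f \<le> integral\<^sup>L representing_measure f"
proof (rule field_le_epsilon)
  fix e :: real
  assume "0 < e"
  then obtain n where "0 < n" "1 / real n < e"
    by (metis nat_approx_posE of_nat_0_less_iff zero_less_Suc)
  then show "\<Lambda> f \<le> integral\<^sup>L representing_measure f + e"
    using functional_le_integral_aux[OF assms, of n] by simp
qed

text \<open>Equality follows from the upper bound for the functional because the bound also holds for
  \<open>1 - g\<close>; every continuous function is an affine function of some \<open>g\<close> with values in \<open>[0, 1]\<close>.\<close>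

theorem integral_representing_measure:
  assumes f: "continuous_on UNIV f"
  shows "\<Lambda> f = integral\<^sup>L representing_measure f"
proof -
  interpret prob_space representing_measure
    by (rule prob_space_representing_measure)
  obtain B where B: "0 < B" "\<And>x. \<bar>f x\<bar> \<le> B"
    using bounded_continuous_compact_UNIV[OF compact_UNIV f] by auto
  have [measurable]: "f \<in> borel_measurable representing_measure"
    using f borel_measurable_continuous_onI
      measurable_cong_sets[OF sets_representing_measure refl] by blast
  have f_int: "integrable representing_measure f"
    using B(2) by (intro integrable_const_bound[of _ B]) auto
  define g where "g x = (f x + B) / (2 * B)" for x
  have g: "continuous_on UNIV g" "0 \<le> g x" "g x \<le> 1" for x
    using B(1) B(2)[of x] by (auto simp: g_def divide_simps intro!: continuous_intros f)
  have g_int: "integrable representing_measure g"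
    unfolding g_def using f_int by simp
  have "\<Lambda> (\<lambda>x. 1 - g x) \<le> integral\<^sup>L representing_measure (\<lambda>x. 1 - g x)"
    by (rule functional_le_integral) (auto intro!: continuous_intros g)
  then have "\<Lambda> g = integral\<^sup>L representing_measure g"
    using functional_le_integral[OF g] g_int by (simp add: diff g(1) const prob_space)
  moreover have f_eq: "f = (\<lambda>x. 2 * B * g x - B)"
    using B(1) by (simp add: g_def fun_eq_iff)
  have "\<Lambda> f = 2 * B * \<Lambda> g - B"
    unfolding f_eq using g(1) by (simp add: diff scale const continuous_on_mult_left)
  moreover have "integral\<^sup>L representing_measure f = 2 * B * integral\<^sup>L representing_measure g - B"
    unfolding f_eq using g_int by (simp add: prob_space)
  ultimately show ?thesis
    by simp
qed

end

lemma C0_of_real_iff: "(\<lambda>x. of_real (f x)) \<in> C0 \<longleftrightarrow> continuous_on UNIV f"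
proof
  assume "(\<lambda>x. complex_of_real (f x)) \<in> C0"
  then have "continuous_on UNIV (\<lambda>x. Re (complex_of_real (f x)))"
    unfolding C0_def by (intro continuous_intros) auto
  then show "continuous_on UNIV f"
    by simp
qed (auto simp: C0_def intro!: continuous_intros)

lemma borel_measurable_prob_measures:
  fixes f :: "'a::topological_space \<Rightarrow> 'b::topological_space"
  assumes "\<nu> \<in> prob_measures"
  shows "f \<in> borel_measurable \<nu> \<longleftrightarrow> f \<in> borel_measurable borel"
  using assms measurable_cong_sets[of \<nu> borel borel borel] by (auto simp: prob_measures_def)

lemma integrable_C0:
  fixes \<phi> :: "'a::metric_space \<Rightarrow> complex"
  assumes "compact (UNIV :: 'a set)" "\<nu> \<in> prob_measures" "\<phi> \<in> C0"
  shows "integrable \<nu> \<phi>"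
proof -
  interpret prob_space \<nu>
    using assms(2) by (simp add: prob_measures_def)
  obtain B where "\<And>x. norm (\<phi> x) \<le> B"
    using bounded_continuous_compact_UNIV[OF assms(1), of \<phi>] assms(3) by (auto simp: C0_def)
  then show ?thesis
    using assms(3) borel_measurable_continuous_onI[of \<phi>]
    by (intro integrable_const_bound[of _ B]) (auto simp: C0_def borel_measurable_prob_measures[OF assms(2)])
qed

text \<open>The complex form reduces to the real one because positivity makes \<open>J\<close> real on real functions,
  and linearity recovers \<open>J\<close> from its values on real and imaginary parts.\<close>

theorem Riesz_representation_complex:
  fixes J :: "('a::metric_space \<Rightarrow> complex) \<Rightarrow> complex"
  assumes compact: "compact (UNIV :: 'a set)"
    and add: "\<And>\<phi> \<psi>. \<phi> \<in> C0 \<Longrightarrow> \<psi> \<in> C0 \<Longrightarrow> J (\<lambda>x. \<phi> x + \<psi> x) = J \<phi> + J \<psi>"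
    and scale: "\<And>c \<phi>. \<phi> \<in> C0 \<Longrightarrow> J (\<lambda>x. c * \<phi> x) = c * J \<phi>"
    and nonneg: "\<And>\<phi>. \<phi> \<in> C0 \<Longrightarrow> (\<And>x. \<phi> x \<in> \<real>\<^sub>\<ge>\<^sub>0) \<Longrightarrow> J \<phi> \<in> \<real>\<^sub>\<ge>\<^sub>0"
    and one: "J (\<lambda>_. 1) = 1"
  shows "\<exists>!\<nu>. \<nu> \<in> prob_measures \<and> (\<forall>\<phi>\<in>C0. J \<phi> = integral\<^sup>L \<nu> \<phi>)"
proof -
  define \<Lambda> where "\<Lambda> f = Re (J (\<lambda>x. of_real (f x)))" for f
  have cont_C0: "(\<lambda>x. complex_of_real (f x)) \<in> C0" if "continuous_on UNIV f" for f
    using that by (simp add: C0_of_real_iff)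
  have const_C0: "(\<lambda>_. c) \<in> C0" for c
    by (simp add: C0_def)
  \<comment> \<open>A real continuous function is a nonnegative one minus a constant, so \<open>J\<close> is real on it.\<close>
  have J_real: "J (\<lambda>x. of_real (f x)) = of_real (\<Lambda> f)" if f: "continuous_on UNIV f" for f
  proof -
    obtain B where B: "\<And>x. \<bar>f x\<bar> \<le> B"
      using bounded_continuous_compact_UNIV[OF compact f] by auto
    have "J (\<lambda>x. of_real (f x) + of_real B) \<in> \<real>\<^sub>\<ge>\<^sub>0"
    proof (rule nonneg)
      show "(\<lambda>x. complex_of_real (f x) + complex_of_real B) \<in> C0"
        using cont_C0[of "\<lambda>x. f x + B"] f by (simp add: continuous_on_add)
      show "complex_of_real (f x) + complex_of_real B \<in> \<real>\<^sub>\<ge>\<^sub>0" for x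
        using B[of x] by (simp flip: of_real_add)
    qed
    moreover have "J (\<lambda>x. of_real (f x) + of_real B) = J (\<lambda>x. of_real (f x)) + of_real B"
      using add[OF cont_C0[OF f] const_C0, of "of_real B"] scale[OF const_C0, of "of_real B" 1] one
      by simp
    ultimately show ?thesis
      by (simp add: \<Lambda>_def complex_eq_iff complex_nonneg_Reals_iff)
  qed
  interpret \<Lambda>: normalised_positive_functional \<Lambda>
  proof
    show "compact (UNIV :: 'a set)" by fact
    show "\<Lambda> (\<lambda>x. f x + g x) = \<Lambda> f + \<Lambda> g" if "continuous_on UNIV f" "continuous_on UNIV g" for f g
      using add[OF that[THEN cont_C0]] by (simp add: \<Lambda>_def)
    show "\<Lambda> (\<lambda>x. c * f x) = c * \<Lambda> f" if "continuous_on UNIV f" for c f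
      using scale[OF cont_C0[OF that], of "of_real c"] by (simp add: \<Lambda>_def)
    show "0 \<le> \<Lambda> f" if "continuous_on UNIV f" "\<And>x. 0 \<le> f x" for f
      using nonneg[OF cont_C0[OF that(1)]] that(2) by (simp add: \<Lambda>_def complex_nonneg_Reals_iff)
    show "\<Lambda> (\<lambda>_. 1) = 1"
      by (simp add: \<Lambda>_def one)
  qed
  define \<nu> where "\<nu> = \<Lambda>.representing_measure"
  have \<nu>: "\<nu> \<in> prob_measures"
    by (simp add: \<nu>_def prob_measures_def \<Lambda>.prob_space_representing_measure
      \<Lambda>.sets_representing_measure)
  have "J \<phi> = integral\<^sup>L \<nu> \<phi>" if \<phi>: "\<phi> \<in> C0" for \<phi>
  proof -
    have cont: "continuous_on UNIV (\<lambda>x. Re (\<phi> x))" "continuous_on UNIV (\<lambda>x. Im (\<phi> x))"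
      using \<phi> by (auto simp: C0_def intro!: continuous_intros)
    have int: "integrable \<nu> \<phi>"
      by (rule integrable_C0[OF compact \<nu> \<phi>])
    have "(\<lambda>x. \<i> * complex_of_real (Im (\<phi> x))) \<in> C0"
      unfolding C0_def using cont by (auto intro!: continuous_intros)
    then have "J (\<lambda>x. of_real (Re (\<phi> x)) + \<i> * of_real (Im (\<phi> x)))
        = of_real (\<Lambda> (\<lambda>x. Re (\<phi> x))) + \<i> * of_real (\<Lambda> (\<lambda>x. Im (\<phi> x)))"
      using add[OF cont_C0[OF cont(1)], of "\<lambda>x. \<i> * of_real (Im (\<phi> x))"]
        scale[OF cont_C0[OF cont(2)], of "\<i>"] cont
      by (simp add: J_real)
    then have "J \<phi> = of_real (integral\<^sup>L \<nu> (\<lambda>x. Re (\<phi> x))) + \<i> * of_real (integral\<^sup>L \<nu> (\<lambda>x. Im (\<phi> x)))"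
      using cont by (simp add: \<Lambda>.integral_representing_measure \<nu>_def flip: complex_eq)
    also have "\<dots> = integral\<^sup>L \<nu> \<phi>"
      using int by (simp add: complex_eq_iff)
    finally show ?thesis .
  qed
  moreover have "\<nu>1 = \<nu>2"
    if 1: "\<nu>1 \<in> prob_measures" "\<forall>\<phi>\<in>C0. J \<phi> = integral\<^sup>L \<nu>1 \<phi>"
      and 2: "\<nu>2 \<in> prob_measures" "\<forall>\<phi>\<in>C0. J \<phi> = integral\<^sup>L \<nu>2 \<phi>" for \<nu>1 \<nu>2
  proof (rule prob_borel_eqI_continuous[OF 1(1) 2(1)])
    fix f :: "'a \<Rightarrow> real"
    assume "continuous_on UNIV f"
    from cont_C0[OF this] have "integral\<^sup>L \<nu>1 (\<lambda>x. complex_of_real (f x)) = integral\<^sup>L \<nu>2 (\<lambda>x. complex_of_real (f x))"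
      using 1(2) 2(2) by metis
    then show "integral\<^sup>L \<nu>1 f = integral\<^sup>L \<nu>2 f"
      by simp
  qed
  ultimately show ?thesis
    using \<nu> by blast
qed

section \<open>The transition probabilities of a transfer operator form a Markov kernel\<close>

lemma bind_in_prob_measures:
  fixes \<nu> :: "'a::topological_space measure"
  assumes "\<nu> \<in> prob_measures" "K \<in> borel \<rightarrow>\<^sub>M prob_algebra borel"
  shows "\<nu> \<bind> K \<in> prob_measures"
proof -
  have "\<nu> \<in> space (prob_algebra borel)"
    using assms(1) by (simp add: prob_measures_def space_prob_algebra)
  then show ?thesis
    using prob_space_bind' sets_bind' assms(2) unfolding prob_measures_def by blast
qed

context
  fixes L :: "('a::metric_space \<Rightarrow> complex) \<Rightarrow> ('a \<Rightarrow> complex)"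
  assumes compact: "compact (UNIV :: 'a set)" and transfer: "transfer_operator L"
begin

lemma transition_prob_representation:
  "transition_prob L x \<in> prob_measures \<and> (\<forall>\<phi>\<in>C0. L \<phi> x = integral\<^sup>L (transition_prob L x) \<phi>)"
  unfolding transition_prob_def
  by (rule theI', rule Riesz_representation_complex[OF compact])
     (use transfer in \<open>auto simp: transfer_operator_def\<close>)

lemma transition_prob_in_prob_measures: "transition_prob L x \<in> prob_measures"
  using transition_prob_representation by blast

lemma integral_transition_prob: "\<phi> \<in> C0 \<Longrightarrow> integral\<^sup>L (transition_prob L x) \<phi> = L \<phi> x"
  using transition_prob_representation by metis

lemma of_real_integral_transition_prob:
  fixes f :: "'a \<Rightarrow> real"
  assumes "continuous_on UNIV f"
  shows "of_real (integral\<^sup>L (transition_prob L x) f) = L (\<lambda>x. of_real (f x)) x"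
  using integral_transition_prob[of "\<lambda>x. of_real (f x)" x] assms by (simp add: C0_of_real_iff)

lemma continuous_on_integral_transition_prob:
  fixes f :: "'a \<Rightarrow> real"
  assumes "continuous_on UNIV f"
  shows "continuous_on UNIV (\<lambda>x. integral\<^sup>L (transition_prob L x) f)"
proof -
  have f: "(\<lambda>x. complex_of_real (f x)) \<in> C0"
    using assms by (simp add: C0_of_real_iff)
  have "integral\<^sup>L (transition_prob L x) f = Re (L (\<lambda>x. of_real (f x)) x)" for x
    using of_real_integral_transition_prob[OF assms, of x] by (metis Re_complex_of_real)
  moreover have "continuous_on UNIV (\<lambda>x. Re (L (\<lambda>x. of_real (f x)) x))"
    using f transfer by (auto simp: transfer_operator_def C0_def intro!: continuous_intros)
  ultimately show ?thesis
    by simp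
qed

text \<open>On open sets the kernel is an increasing limit of continuous functions, and the open sets
  generate.\<close>

lemma measurable_transition_prob: "transition_prob L \<in> borel \<rightarrow>\<^sub>M prob_algebra borel"
proof (rule measurable_prob_algebra_generated[where \<Omega> = UNIV and G = "{S. open S}"])
  show "(\<lambda>x. emeasure (transition_prob L x) U) \<in> borel_measurable borel" if "U \<in> {S. open S}" for U
  proof -
    have U: "open U" using that by simp
    obtain g :: "nat \<Rightarrow> 'a \<Rightarrow> real" where g:
      "\<And>k. continuous_on UNIV (g k)" "\<And>k x. 0 \<le> g k x" "\<And>k x. g k x \<le> indicator U x"
      "\<And>j k x. j \<le> k \<Longrightarrow> g j x \<le> g k x" "\<And>x. x \<in> U \<Longrightarrow> \<exists>k. g k x = 1"
      by (rule open_bump_sequence[OF U]) blast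
    have "emeasure (transition_prob L x) U = (SUP k. ennreal (integral\<^sup>L (transition_prob L x) (g k)))" for x
      using transition_prob_in_prob_measures
      by (intro emeasure_open_eq_SUP_bump g U) (auto simp: prob_measures_def)
    moreover have [measurable]: "(\<lambda>x. integral\<^sup>L (transition_prob L x) (g k)) \<in> borel_measurable borel" for k
      by (intro borel_measurable_continuous_onI continuous_on_integral_transition_prob g)
    ultimately show ?thesis
      by simp
  qed
qed (use transition_prob_in_prob_measures in \<open>auto simp: Int_stable_def sets_borel prob_measures_def\<close>)

text \<open>The measure singled out in the definition of the dual exists, because \<open>\<phi> \<mapsto> \<integral>L \<phi> d\<mu>\<close> is again a
  normalised positive functional.\<close>

lemma dual_transfer_representation:
  assumes \<mu>: "\<mu> \<in> prob_measures" and "\<phi> \<in> C0"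
  shows "integral\<^sup>L (dual_transfer L \<mu>) \<phi> = integral\<^sup>L \<mu> (L \<phi>)"
proof -
  have int: "integrable \<mu> (L \<phi>)" if "\<phi> \<in> C0" for \<phi>
    using integrable_C0[OF compact \<mu>] transfer that by (auto simp: transfer_operator_def)
  have "\<exists>!\<nu>. \<nu> \<in> prob_measures \<and> (\<forall>\<phi>\<in>C0. integral\<^sup>L \<mu> (L \<phi>) = integral\<^sup>L \<nu> \<phi>)"
  proof (rule Riesz_representation_complex[OF compact])
    fix \<phi> :: "'a \<Rightarrow> complex"
    assume \<phi>: "\<phi> \<in> C0"
    show "integral\<^sup>L \<mu> (L (\<lambda>x. \<phi> x + \<psi> x)) = integral\<^sup>L \<mu> (L \<phi>) + integral\<^sup>L \<mu> (L \<psi>)"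
      if "\<psi> \<in> C0" for \<psi>
      using transfer \<phi> that int by (simp add: transfer_operator_def)
    show "integral\<^sup>L \<mu> (L (\<lambda>x. c * \<phi> x)) = c * integral\<^sup>L \<mu> (L \<phi>)" for c
      using transfer \<phi> int by (simp add: transfer_operator_def)
    show "integral\<^sup>L \<mu> (L \<phi>) \<in> \<real>\<^sub>\<ge>\<^sub>0" if "\<And>x. \<phi> x \<in> \<real>\<^sub>\<ge>\<^sub>0"
    proof -
      have "L \<phi> x \<in> \<real>\<^sub>\<ge>\<^sub>0" for x
        using transfer \<phi> that by (simp add: transfer_operator_def)
      then have L: "0 \<le> Re (L \<phi> x)" "L \<phi> x = of_real (Re (L \<phi> x))" for x
        by (auto simp: complex_nonneg_Reals_iff complex_eq_iff)
      have "integral\<^sup>L \<mu> (L \<phi>) = integral\<^sup>L \<mu> (\<lambda>x. complex_of_real (Re (L \<phi> x)))"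
        by (rule Bochner_Integration.integral_cong[OF refl L(2)])
      also have "\<dots> = of_real (integral\<^sup>L \<mu> (\<lambda>x. Re (L \<phi> x)))"
        by (rule integral_complex_of_real)
      finally show ?thesis
        using L(1) by simp
    qed
  next
    interpret prob_space \<mu>
      using \<mu> by (simp add: prob_measures_def)
    show "integral\<^sup>L \<mu> (L (\<lambda>_. 1)) = 1"
      using transfer by (simp add: transfer_operator_def prob_space)
  qed
  then have "\<exists>!\<nu>. \<nu> \<in> prob_measures \<and> (\<forall>\<phi>\<in>C0. integral\<^sup>L \<nu> \<phi> = integral\<^sup>L \<mu> (L \<phi>))"
    by (simp add: eq_commute)
  from theI'[OF this] show ?thesis
    using \<open>\<phi> \<in> C0\<close> by (simp add: dual_transfer_def)
qed

lemma integral_dual_transfer_fixpoint: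
  fixes f :: "'a \<Rightarrow> real"
  assumes "\<mu> \<in> prob_measures" "dual_transfer L \<mu> = \<mu>" "continuous_on UNIV f"
  shows "(\<integral>x. integral\<^sup>L (transition_prob L x) f \<partial>\<mu>) = integral\<^sup>L \<mu> f"
proof -
  have "complex_of_real (\<integral>x. integral\<^sup>L (transition_prob L x) f \<partial>\<mu>)
      = (\<integral>x. complex_of_real (integral\<^sup>L (transition_prob L x) f) \<partial>\<mu>)"
    by (rule integral_complex_of_real[symmetric])
  also have "\<dots> = integral\<^sup>L \<mu> (L (\<lambda>x. of_real (f x)))"
    by (simp add: of_real_integral_transition_prob assms(3))
  also have "\<dots> = integral\<^sup>L \<mu> (\<lambda>x. of_real (f x))"
    using dual_transfer_representation[OF assms(1), of "\<lambda>x. of_real (f x)"] assms(2,3)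
    by (simp add: C0_of_real_iff)
  finally show ?thesis
    by simp
qed

text \<open>Invariance under the dual operator is a statement about continuous functions. Monotone
  limits along bumps carry it over to open sets, hence to all Borel sets: \<open>\<mu>\<close> is a stationary
  distribution of the kernel.\<close>

lemma dual_transfer_fixpoint_bind:
  assumes \<mu>: "\<mu> \<in> prob_measures" and fixpoint: "dual_transfer L \<mu> = \<mu>"
  shows "\<mu> \<bind> transition_prob L = \<mu>"
proof (rule measure_eqI_generator_eq[where \<Omega> = UNIV and E = "{S. open S}" and A = "\<lambda>_. UNIV"])
  have bind: "\<mu> \<bind> transition_prob L \<in> prob_measures"
    by (rule bind_in_prob_measures[OF \<mu> measurable_transition_prob])
  then show "sets (\<mu> \<bind> transition_prob L) = sigma_sets UNIV {S. open S}"
    by (simp add: prob_measures_def sets_borel)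
  show "sets \<mu> = sigma_sets UNIV {S. open S}"
    using \<mu> by (simp add: prob_measures_def sets_borel)
  interpret B: prob_space "\<mu> \<bind> transition_prob L"
    using bind by (simp add: prob_measures_def)
  show "emeasure (\<mu> \<bind> transition_prob L) UNIV \<noteq> \<infinity>"
    by simp
  show "emeasure (\<mu> \<bind> transition_prob L) U = emeasure \<mu> U" if "U \<in> {S. open S}" for U
  proof -
    have U: "open U" using that by simp
    have p: "prob_space \<mu>" "sets \<mu> = sets borel"
      using \<mu> by (auto simp: prob_measures_def)
    interpret prob_space \<mu> by fact
    obtain g :: "nat \<Rightarrow> 'a \<Rightarrow> real" where g:
      "\<And>k. continuous_on UNIV (g k)" "\<And>k x. 0 \<le> g k x" "\<And>k x. g k x \<le> indicator U x"
      "\<And>j k x. j \<le> k \<Longrightarrow> g j x \<le> g k x" "\<And>x. x \<in> U \<Longrightarrow> \<exists>k. g k x = 1"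
      by (rule open_bump_sequence[OF U]) blast
    have K: "transition_prob L x \<in> prob_measures" "prob_space (transition_prob L x)"
        "sets (transition_prob L x) = sets borel" for x
      using transition_prob_in_prob_measures[of x] by (auto simp: prob_measures_def)
    define h where "h k x = integral\<^sup>L (transition_prob L x) (g k)" for k x
    have "\<bar>g k x\<bar> \<le> 1" for k x
      using g(2,3)[of k x] indicator_le_1[of U x] by (smt (verit))
    then have g_int: "integrable \<nu> (g k)" if "\<nu> \<in> prob_measures" for \<nu> k
      using that g(1) borel_measurable_continuous_onI[of "g k"]
      by (intro finite_measure.integrable_const_bound[of _ _ 1])
         (auto simp: prob_measures_def prob_space_def borel_measurable_prob_measures)
    have h_nonneg: "0 \<le> h k x" for k x
      unfolding h_def by (intro integral_nonneg_AE AE_I2 g)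
    have h_mono: "h j x \<le> h k x" if "j \<le> k" for j k x
      unfolding h_def by (intro integral_mono g_int K g that)
    have h_cont: "continuous_on UNIV (h k)" for k
      unfolding h_def by (intro continuous_on_integral_transition_prob g)
    then have [measurable]: "h k \<in> borel_measurable \<mu>" for k
      using borel_measurable_continuous_onI by (auto simp: borel_measurable_prob_measures[OF \<mu>])
    have h_int: "integrable \<mu> (h k)" for k
    proof -
      obtain B where "\<And>x. norm (h k x) \<le> B"
        using bounded_continuous_compact_UNIV[OF compact h_cont] by blast
      then show ?thesis
        by (intro integrable_const_bound[of _ B]) auto
    qed
    have "emeasure (\<mu> \<bind> transition_prob L) U = (\<integral>\<^sup>+x. emeasure (transition_prob L x) U \<partial>\<mu>)"
      using \<mu> U
      by (intro emeasure_bind_prob_algebra[OF _ measurable_transition_prob])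
         (auto simp: prob_measures_def space_prob_algebra)
    also have "\<dots> = (\<integral>\<^sup>+x. (SUP k. ennreal (h k x)) \<partial>\<mu>)"
      unfolding h_def using K by (intro nn_integral_cong emeasure_open_eq_SUP_bump g U) auto
    also have "\<dots> = (SUP k. \<integral>\<^sup>+x. ennreal (h k x) \<partial>\<mu>)"
      by (intro nn_integral_monotone_convergence_SUP)
         (auto simp: incseq_def le_fun_def intro!: ennreal_leI h_mono)
    also have "\<dots> = (SUP k. ennreal (integral\<^sup>L \<mu> (h k)))"
      using h_int h_nonneg by (simp add: nn_integral_eq_integral)
    also have "\<dots> = (SUP k. ennreal (integral\<^sup>L \<mu> (g k)))"
      unfolding h_def by (simp add: integral_dual_transfer_fixpoint[OF \<mu> fixpoint g(1)])
    also have "\<dots> = emeasure \<mu> U"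
      by (rule emeasure_open_eq_SUP_bump[OF p g U, symmetric])
    finally show ?thesis .
  qed
qed (auto simp: Int_stable_def)

end

section \<open>Markov kernels acting on universally measurable functions\<close>

text \<open>A real function has a Borel version for a measure if and only if it is measurable for the
  completion of that measure. Integrating against completions avoids the choice of a version, and
  makes the integral additive and monotone at once.\<close>

definition univ_measurable :: "('a::topological_space \<Rightarrow> real) set" where
  "univ_measurable = {f. bounded (range f) \<and> (\<forall>\<nu>\<in>prob_measures. f \<in> borel_measurable (completion \<nu>))}"

lemma univ_measurable_bound:
  assumes "f \<in> univ_measurable"
  obtains B where "\<And>x. \<bar>f x\<bar> \<le> B"
  using assms unfolding univ_measurable_def bounded_iff by auto

lemma univ_measurable_measurable:
  "f \<in> univ_measurable \<Longrightarrow> \<nu> \<in> prob_measures \<Longrightarrow> f \<in> borel_measurable (completion \<nu>)"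
  by (simp add: univ_measurable_def)

lemma univ_measurableI:
  assumes "\<And>x. \<bar>f x\<bar> \<le> B" "\<And>\<nu>. \<nu> \<in> prob_measures \<Longrightarrow> f \<in> borel_measurable (completion \<nu>)"
  shows "f \<in> univ_measurable"
  unfolding univ_measurable_def using assms by (auto intro!: boundedI[of _ B])

lemma univ_measurable_const: "(\<lambda>_. c) \<in> univ_measurable"
  by (rule univ_measurableI[of _ "\<bar>c\<bar>"]) auto

lemma univ_measurable_add:
  assumes "f \<in> univ_measurable" "g \<in> univ_measurable"
  shows "(\<lambda>x. f x + g x) \<in> univ_measurable"
proof -
  obtain B C where "\<And>x. \<bar>f x\<bar> \<le> B" "\<And>x. \<bar>g x\<bar> \<le> C"
    using assms univ_measurable_bound by metis
  then have "\<bar>f x + g x\<bar> \<le> B + C" for x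
    by (meson abs_triangle_ineq add_mono order_trans)
  then show ?thesis
  proof (rule univ_measurableI)
    fix \<nu> :: "'a measure" assume "\<nu> \<in> prob_measures"
    then show "(\<lambda>x. f x + g x) \<in> borel_measurable (completion \<nu>)"
      using assms by (intro borel_measurable_add univ_measurable_measurable)
  qed
qed

lemma univ_measurable_max:
  assumes "f \<in> univ_measurable" "g \<in> univ_measurable"
  shows "(\<lambda>x. max (f x) (g x)) \<in> univ_measurable"
proof -
  obtain B C where "\<And>x. \<bar>f x\<bar> \<le> B" "\<And>x. \<bar>g x\<bar> \<le> C"
    using assms univ_measurable_bound by metis
  then have "\<bar>max (f x) (g x)\<bar> \<le> max B C" for x
    by (smt (verit))
  then show ?thesis
  proof (rule univ_measurableI)
    fix \<nu> :: "'a measure" assume "\<nu> \<in> prob_measures"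
    then show "(\<lambda>x. max (f x) (g x)) \<in> borel_measurable (completion \<nu>)"
      using assms by (intro borel_measurable_max univ_measurable_measurable)
  qed
qed

lemma prob_space_completion:
  assumes "prob_space M"
  shows "prob_space (completion M)"
  using prob_space.emeasure_space_1[OF assms] by (intro prob_spaceI) simp

lemma univ_measurable_integrable:
  assumes "f \<in> univ_measurable" "\<nu> \<in> prob_measures"
  shows "integrable (completion \<nu>) f"
proof -
  interpret prob_space "completion \<nu>"
    using assms(2) by (auto simp: prob_measures_def intro: prob_space_completion)
  obtain B where "\<And>x. \<bar>f x\<bar> \<le> B"
    using assms(1) univ_measurable_bound by metis
  then show ?thesis
    using assms by (intro integrable_const_bound[of _ B] univ_measurable_measurable) auto
qed

text \<open>The exceptional null set is taken to be Borel, so that it is an event for every measure of a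
  kernel.\<close>

lemma completion_borel_version:
  fixes f :: "'a::topological_space \<Rightarrow> real" and \<nu> :: "'a measure"
  assumes "f \<in> borel_measurable (completion \<nu>)" "\<nu> \<in> prob_measures"
  obtains g N where "g \<in> borel_measurable borel" "N \<in> sets borel" "emeasure \<nu> N = 0"
    "\<And>x. x \<notin> N \<Longrightarrow> f x = g x"
proof -
  obtain g where g: "g \<in> borel_measurable \<nu>" "AE x in \<nu>. f x = g x"
    using completion_ex_borel_measurable_real[OF assms(1)] by blast
  obtain N where "{x \<in> space \<nu>. \<not> f x = g x} \<subseteq> N" "emeasure \<nu> N = 0" "N \<in> sets \<nu>"
    using AE_E[OF g(2)] by blast
  moreover have "space \<nu> = UNIV" "sets \<nu> = sets borel"
    using assms(2) sets_eq_imp_space_eq[of \<nu> borel] by (auto simp: prob_measures_def)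
  ultimately show ?thesis
    using g(1) assms(2) by (intro that[of g N]) (auto simp: borel_measurable_prob_measures)
qed

lemma completion_measurable_AE:
  fixes f g :: "'a \<Rightarrow> 'b::topological_space"
  assumes "g \<in> M \<rightarrow>\<^sub>M borel" "AE x in M. f x = g x"
  shows "f \<in> completion M \<rightarrow>\<^sub>M borel"
proof (rule measurableI)
  fix A :: "'b set"
  assume A: "A \<in> sets borel"
  have "AE x in completion M. x \<in> g -` A \<inter> space M \<longleftrightarrow> x \<in> f -` A \<inter> space M"
    using AE_completion[OF assms(2)] by eventually_elim auto
  moreover have "g -` A \<inter> space M \<in> sets (completion M)"
    using measurable_sets[OF assms(1) A] by simp
  ultimately have "f -` A \<inter> space M \<in> sets (completion M)"
    by (rule completion.in_sets_AE) auto
  then show "f -` A \<inter> space (completion M) \<in> sets (completion M)"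
    by simp
qed simp

lemma integral_completion_eq:
  fixes f g :: "'a \<Rightarrow> 'b::{banach,second_countable_topology}"
  assumes "g \<in> borel_measurable M" "AE x in M. f x = g x"
  shows "integral\<^sup>L (completion M) f = integral\<^sup>L M g"
proof -
  have "integral\<^sup>L (completion M) f = integral\<^sup>L (completion M) g"
    by (rule integral_cong_AE[OF completion_measurable_AE[OF assms]
          measurable_completion[OF assms(1)] AE_completion[OF assms(2)]])
  then show ?thesis
    by (simp add: integral_completion[OF assms(1)])
qed

locale markov_kernel =
  fixes K :: "'a::topological_space \<Rightarrow> 'a measure"
  assumes measurable_kernel: "K \<in> borel \<rightarrow>\<^sub>M prob_algebra borel"
begin

lemma kernel_in_prob_measures: "K x \<in> prob_measures"
  using measurable_space[OF measurable_kernel, of x] by (simp add: space_prob_algebra prob_measures_def)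

definition average :: "('a \<Rightarrow> real) \<Rightarrow> 'a \<Rightarrow> real" where
  "average f x = integral\<^sup>L (completion (K x)) f"

lemma average_add:
  assumes "f \<in> univ_measurable" "g \<in> univ_measurable"
  shows "average (\<lambda>x. f x + g x) = (\<lambda>x. average f x + average g x)"
  unfolding average_def
  by (intro ext Bochner_Integration.integral_add univ_measurable_integrable assms kernel_in_prob_measures)

lemma average_mono:
  assumes "f \<in> univ_measurable" "g \<in> univ_measurable" "\<And>x. f x \<le> g x"
  shows "average f x \<le> average g x"
  unfolding average_def
  by (intro integral_mono univ_measurable_integrable assms kernel_in_prob_measures)

lemma average_const: "average (\<lambda>_. c) = (\<lambda>_. c)"
proof
  fix x
  interpret prob_space "K x"
    using kernel_in_prob_measures[of x] by (simp add: prob_measures_def)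
  show "average (\<lambda>_. c) x = c"
    by (simp add: average_def prob_space)
qed

text \<open>A Borel null set for \<open>\<nu> \<bind> K\<close> is null for \<open>K x\<close>, for \<open>\<nu>\<close>-almost all \<open>x\<close>. So one Borel version
  of \<open>f\<close>, chosen for the measure \<open>\<nu> \<bind> K\<close>, serves for almost all measures \<open>K x\<close>.\<close>

lemma kernel_borel_version:
  assumes f: "f \<in> univ_measurable" and \<nu>: "\<nu> \<in> prob_measures"
  obtains g where "g \<in> borel_measurable borel" "AE x in \<nu> \<bind> K. f x = g x"
    "AE x in \<nu>. AE y in K x. f y = g y"
proof -
  have K: "K \<in> \<nu> \<rightarrow>\<^sub>M subprob_algebra borel"
    using measurable_prob_algebraD[OF measurable_kernel] \<nu> measurable_cong_sets[of \<nu> borel]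
    by (auto simp: prob_measures_def)
  have bind: "\<nu> \<bind> K \<in> prob_measures"
    by (rule bind_in_prob_measures[OF \<nu> measurable_kernel])
  obtain g N where g: "g \<in> borel_measurable borel" and N[measurable]: "N \<in> sets borel"
    and null: "emeasure (\<nu> \<bind> K) N = 0" and eq: "\<And>x. x \<notin> N \<Longrightarrow> f x = g x"
    using completion_borel_version[OF univ_measurable_measurable[OF f bind] bind] by blast
  have "N \<in> null_sets (\<nu> \<bind> K)"
    using null N bind by (auto simp: null_sets_def prob_measures_def)
  then have ae: "AE x in \<nu> \<bind> K. x \<notin> N"
    by (rule AE_not_in)
  then have "AE x in \<nu>. AE y in K x. y \<notin> N"
    by (subst (asm) AE_bind[OF K]) auto
  then have "AE x in \<nu>. AE y in K x. f y = g y"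
  proof eventually_elim
    case (elim x)
    then show ?case
      by eventually_elim (rule eq)
  qed
  moreover have "AE x in \<nu> \<bind> K. f x = g x"
    using ae by eventually_elim (rule eq)
  ultimately show ?thesis
    using g by (intro that)
qed

text \<open>For every \<open>\<nu>\<close>, the average of \<open>f\<close> agrees \<open>\<nu>\<close>-almost everywhere with the average of a Borel
  version, which is a Borel function since the kernel is measurable.\<close>

lemma average_univ_measurable:
  assumes f: "f \<in> univ_measurable"
  shows "average f \<in> univ_measurable"
proof -
  obtain B where B: "\<And>x. \<bar>f x\<bar> \<le> B"
    using f univ_measurable_bound by metis
  have "- B \<le> f x" "f x \<le> B" for x
    using B[of x] by (auto simp: abs_le_iff)
  then have "- B \<le> average f x" "average f x \<le> B" for x
    using average_mono[OF f univ_measurable_const, of B x]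
      average_mono[OF univ_measurable_const f, of "- B" x]
    by (simp_all add: average_const)
  then have "\<bar>average f x\<bar> \<le> B" for x
    by (simp add: abs_le_iff minus_le_iff)
  then show ?thesis
  proof (rule univ_measurableI)
    fix \<nu> :: "'a measure" assume \<nu>: "\<nu> \<in> prob_measures"
    obtain g where g: "g \<in> borel_measurable borel" "AE x in \<nu>. AE y in K x. f y = g y"
      using kernel_borel_version[OF f \<nu>] by blast
    have "(\<lambda>x. integral\<^sup>L (K x) g) \<in> borel_measurable borel"
      using measurable_compose[OF measurable_prob_algebraD[OF measurable_kernel]
          integral_measurable_subprob_algebra[OF g(1)]] .
    then have "(\<lambda>x. integral\<^sup>L (K x) g) \<in> borel_measurable \<nu>"
      by (simp add: borel_measurable_prob_measures[OF \<nu>])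
    moreover have "AE x in \<nu>. average f x = integral\<^sup>L (K x) g"
      using g(2)
    proof eventually_elim
      case (elim x)
      then show ?case
        unfolding average_def using g(1)
        by (intro integral_completion_eq)
           (simp_all add: borel_measurable_prob_measures[OF kernel_in_prob_measures])
    qed
    ultimately show "average f \<in> borel_measurable (completion \<nu>)"
      by (rule completion_measurable_AE)
  qed
qed

text \<open>For nonnegative functions everything can be computed with Lebesgue integrals in \<open>[0, \<infinity>]\<close>,
  where the integral for \<open>\<mu> \<bind> K\<close> is the iterated integral of a Borel version.\<close>

lemma integral_average_invariant:
  assumes f: "f \<in> univ_measurable" "\<And>x. 0 \<le> f x"
    and \<mu>: "\<mu> \<in> prob_measures" and invariant: "\<mu> \<bind> K = \<mu>"
  shows "integral\<^sup>L (completion \<mu>) (average f) = integral\<^sup>L (completion \<mu>) f"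
proof -
  have K: "K \<in> \<mu> \<rightarrow>\<^sub>M subprob_algebra borel"
    using measurable_prob_algebraD[OF measurable_kernel] \<mu> measurable_cong_sets[of \<mu> borel]
    by (auto simp: prob_measures_def)
  obtain g where g: "g \<in> borel_measurable borel" "AE x in \<mu>. f x = g x"
      "AE x in \<mu>. AE y in K x. f y = g y"
    using kernel_borel_version[OF f(1) \<mu>] unfolding invariant by blast
  have average_nonneg: "0 \<le> average f x" for x
    unfolding average_def using f(2) by simp
  have inner: "ennreal (average f x) = (\<integral>\<^sup>+y. ennreal (f y) \<partial>K x)" for x
    using nn_integral_eq_integral[OF univ_measurable_integrable[OF f(1) kernel_in_prob_measures]] f(2)
    by (simp add: average_def nn_integral_completion)
  have "(\<integral>\<^sup>+x. ennreal (average f x) \<partial>\<mu>) = (\<integral>\<^sup>+x. \<integral>\<^sup>+y. ennreal (g y) \<partial>K x \<partial>\<mu>)"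
    unfolding inner
  proof (rule nn_integral_cong_AE)
    show "AE x in \<mu>. (\<integral>\<^sup>+y. ennreal (f y) \<partial>K x) = (\<integral>\<^sup>+y. ennreal (g y) \<partial>K x)"
      using g(3)
    proof eventually_elim
      case (elim x)
      then have "AE y in K x. ennreal (f y) = ennreal (g y)"
        by eventually_elim simp
      then show ?case
        by (rule nn_integral_cong_AE)
    qed
  qed
  also have "\<dots> = (\<integral>\<^sup>+y. ennreal (g y) \<partial>(\<mu> \<bind> K))"
    using g(1) by (intro nn_integral_bind[symmetric, OF _ K]) simp
  also have "\<dots> = (\<integral>\<^sup>+y. ennreal (f y) \<partial>\<mu>)"
    unfolding invariant
  proof (rule nn_integral_cong_AE)
    show "AE y in \<mu>. ennreal (g y) = ennreal (f y)"
      using g(2) by eventually_elim simp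
  qed
  finally show ?thesis
    using f average_nonneg \<mu>
    by (simp add: integral_eq_nn_integral univ_measurable_measurable average_univ_measurable
        nn_integral_completion)
qed

section \<open>Hopf's maximal ergodic inequality\<close>

definition partial_sum :: "('a \<Rightarrow> real) \<Rightarrow> nat \<Rightarrow> 'a \<Rightarrow> real" where
  "partial_sum f k x = (\<Sum>j<k. (average ^^ j) f x)"

lemma average_iterate_univ_measurable:
  "f \<in> univ_measurable \<Longrightarrow> (average ^^ j) f \<in> univ_measurable"
  by (induction j) (simp_all add: average_univ_measurable)

lemma partial_sum_univ_measurable:
  assumes "f \<in> univ_measurable"
  shows "partial_sum f k \<in> univ_measurable"
  by (induction k)
     (simp_all add: partial_sum_def[abs_def] univ_measurable_const univ_measurable_add
       average_iterate_univ_measurable assms)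

lemma partial_sum_Suc:
  assumes "f \<in> univ_measurable"
  shows "partial_sum f (Suc k) x = f x + average (partial_sum f k) x"
proof (induction k)
  case 0
  then show ?case
    by (simp add: partial_sum_def[abs_def] average_const)
next
  case (Suc k)
  have "partial_sum f (Suc k) = (\<lambda>x. partial_sum f k x + (average ^^ k) f x)"
    by (simp add: partial_sum_def[abs_def])
  then have "average (partial_sum f (Suc k)) x = average (partial_sum f k) x + (average ^^ Suc k) f x"
    by (simp add: average_add partial_sum_univ_measurable average_iterate_univ_measurable assms)
  moreover have "partial_sum f (Suc (Suc k)) x = partial_sum f (Suc k) x + (average ^^ Suc k) f x"
    by (simp add: partial_sum_def)
  ultimately show ?case
    using Suc.IH by simp
qed

text \<open>The maximum includes the empty sum, which makes it nonnegative.\<close>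

definition max_sum :: "('a \<Rightarrow> real) \<Rightarrow> nat \<Rightarrow> 'a \<Rightarrow> real" where
  "max_sum f n x = (MAX k\<in>{..n}. partial_sum f k x)"

lemma max_sum_univ_measurable:
  assumes "f \<in> univ_measurable"
  shows "max_sum f n \<in> univ_measurable"
proof (induction n)
  case 0
  then show ?case
    using partial_sum_univ_measurable[OF assms, of 0] by (simp add: max_sum_def[abs_def])
next
  case (Suc n)
  have "max_sum f (Suc n) = (\<lambda>x. max (partial_sum f (Suc n) x) (max_sum f n x))"
    by (simp add: max_sum_def[abs_def] atMost_Suc)
  then show ?case
    using Suc partial_sum_univ_measurable[OF assms] univ_measurable_max by metis
qed

lemma partial_sum_le_max_sum: "k \<le> n \<Longrightarrow> partial_sum f k x \<le> max_sum f n x"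
  unfolding max_sum_def by (rule Max_ge) auto

lemma max_sum_nonneg: "0 \<le> max_sum f n x"
  using partial_sum_le_max_sum[of 0 n f x] by (simp add: partial_sum_def)

lemma max_sum_pos_iff: "0 < max_sum f n x \<longleftrightarrow> (\<exists>k\<in>{1..n}. 0 < partial_sum f k x)"
proof -
  have "0 < max_sum f n x \<longleftrightarrow> (\<exists>k\<le>n. 0 < partial_sum f k x)"
    unfolding max_sum_def by (subst Max_gr_iff) auto
  moreover have "1 \<le> k" if "0 < partial_sum f k x" for k
    using that by (cases k) (simp_all add: partial_sum_def)
  ultimately show ?thesis
    by auto
qed

text \<open>Garsia's pointwise inequality. If the maximum is positive, it is attained at a nonempty sum
  \<open>partial_sum f (Suc k) = f + average (partial_sum f k)\<close>, and the average of the shorter sum is at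
  most the average of the maximum.\<close>

lemma max_sum_minus_average_le:
  assumes f: "f \<in> univ_measurable"
  shows "max_sum f n x - average (max_sum f n) x \<le> indicator {x. 0 < max_sum f n x} x * f x"
proof (cases "0 < max_sum f n x")
  case True
  have "max_sum f n x \<in> (\<lambda>k. partial_sum f k x) ` {..n}"
    unfolding max_sum_def by (rule Max_in) auto
  then obtain k where k: "k \<le> n" "max_sum f n x = partial_sum f k x"
    by auto
  have "k \<noteq> 0"
  proof
    assume "k = 0"
    with True k(2) show False
      by (simp add: partial_sum_def)
  qed
  then obtain m where m: "k = Suc m"
    using not0_implies_Suc by blast
  have "average (partial_sum f m) x \<le> average (max_sum f n) x"
    using k(1) m by (intro average_mono partial_sum_univ_measurable max_sum_univ_measurable f
        partial_sum_le_max_sum) simp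
  then show ?thesis
    using True k(2) m partial_sum_Suc[OF f, of m x] by simp
next
  case False
  moreover have "0 \<le> average (max_sum f n) x"
    unfolding average_def by (simp add: max_sum_nonneg)
  ultimately show ?thesis
    by simp
qed

text \<open>The indicator of the set over which the theorem integrates keeps the product universally
  measurable, so the integral of the product has a meaning.\<close>

lemma univ_measurable_on_pos_partial_sum:
  assumes f: "f \<in> univ_measurable" and g: "g \<in> univ_measurable"
  shows "(\<lambda>x. indicator {x. \<exists>k\<ge>1. 0 < partial_sum f k x} x * g x) \<in> univ_measurable"
proof -
  obtain B where B: "\<And>x. \<bar>g x\<bar> \<le> B"
    using g univ_measurable_bound by metis
  show ?thesis
  proof (rule univ_measurableI)
    show "\<bar>indicator {x. \<exists>k\<ge>1. 0 < partial_sum f k x} x * g x\<bar> \<le> B" for x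
      using B[of x] by (auto simp: indicator_def)
    fix \<nu> :: "'a measure" assume \<nu>: "\<nu> \<in> prob_measures"
    have space: "space (completion \<nu>) = UNIV"
      using \<nu> sets_eq_imp_space_eq[of \<nu> borel] by (simp add: prob_measures_def)
    have "{x. 0 < partial_sum f k x} \<in> sets (completion \<nu>)" for k
      using borel_measurable_less[OF borel_measurable_const
          univ_measurable_measurable[OF partial_sum_univ_measurable[OF f] \<nu>], of 0 k]
      unfolding space by simp
    moreover have "{x. \<exists>k\<ge>1. 0 < partial_sum f k x} = (\<Union>k\<in>{1..}. {x. 0 < partial_sum f k x})"
      by auto
    ultimately have "{x. \<exists>k\<ge>1. 0 < partial_sum f k x} \<in> sets (completion \<nu>)"
      by (simp add: sets.countable_UN')
    then show "(\<lambda>x. indicator {x. \<exists>k\<ge>1. 0 < partial_sum f k x} x * g x) \<in> borel_measurable (completion \<nu>)"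
      by (intro borel_measurable_times borel_measurable_indicator univ_measurable_measurable[OF g \<nu>])
  qed
qed

text \<open>Integrating Garsia's inequality gives the claim for each finite maximum, because by invariance
  the integral of the left side is \<open>0\<close>. The sets where the maxima are positive increase to the whole
  set, and \<open>\<bar>f\<bar>\<close> dominates.\<close>

theorem maximal_ergodic_inequality:
  assumes f: "f \<in> univ_measurable"
    and \<mu>: "\<mu> \<in> prob_measures" and invariant: "\<mu> \<bind> K = \<mu>"
  shows "0 \<le> (\<integral>x. indicator {x. \<exists>k\<ge>1. 0 < partial_sum f k x} x * f x \<partial>completion \<mu>)"
    (is "0 \<le> (\<integral>x. indicator ?E x * f x \<partial>_)")
proof -
  define E where "E n = {x. 0 < max_sum f n x}" for n
  have space: "space (completion \<mu>) = UNIV"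
    using \<mu> sets_eq_imp_space_eq[of \<mu> borel] by (simp add: prob_measures_def)
  have E_meas[measurable]: "E n \<in> sets (completion \<mu>)" for n
    using borel_measurable_less[OF borel_measurable_const
        univ_measurable_measurable[OF max_sum_univ_measurable[OF f] \<mu>], of 0 n]
    unfolding E_def space by simp
  have [measurable]: "f \<in> borel_measurable (completion \<mu>)"
    by (rule univ_measurable_measurable[OF f \<mu>])
  have f_int: "integrable (completion \<mu>) f"
    by (rule univ_measurable_integrable[OF f \<mu>])
  have E_Un: "?E = (\<Union>n. E n)"
    unfolding E_def max_sum_pos_iff by force
  have "0 \<le> (\<integral>x. indicator (E n) x * f x \<partial>completion \<mu>)" for n
  proof -
    note M = max_sum_univ_measurable[OF f, of n]
    have int: "integrable (completion \<mu>) (max_sum f n)" "integrable (completion \<mu>) (average (max_sum f n))"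
      using M average_univ_measurable[OF M] by (auto intro: univ_measurable_integrable \<mu>)
    have "0 = (\<integral>x. max_sum f n x - average (max_sum f n) x \<partial>completion \<mu>)"
      using int integral_average_invariant[OF M max_sum_nonneg \<mu> invariant] by simp
    also have "\<dots> \<le> (\<integral>x. indicator (E n) x * f x \<partial>completion \<mu>)"
      using int integrable_mult_indicator[OF E_meas f_int, of n] max_sum_minus_average_le[OF f, of n]
      by (intro integral_mono) (auto simp: E_def)
    finally show ?thesis .
  qed
  moreover have "(\<lambda>n. \<integral>x. indicator (E n) x * f x \<partial>completion \<mu>)
      \<longlonglongrightarrow> (\<integral>x. indicator ?E x * f x \<partial>completion \<mu>)"
  proof (rule integral_dominated_convergence[where w = "\<lambda>x. \<bar>f x\<bar>"])
    have "incseq E"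
      unfolding incseq_def E_def max_sum_pos_iff by force
    then show "AE x in completion \<mu>. (\<lambda>n. indicator (E n) x * f x) \<longlonglongrightarrow> indicator ?E x * f x"
      unfolding E_Un by (intro AE_I2 tendsto_mult LIMSEQ_indicator_incseq tendsto_const)
    show "AE x in completion \<mu>. norm (indicator (E n) x * f x) \<le> \<bar>f x\<bar>" for n
      by (intro AE_I2) (auto simp: indicator_def)
    show "(\<lambda>x. indicator ?E x * f x) \<in> borel_measurable (completion \<mu>)"
      unfolding E_Un by measurable
  qed (use f_int in \<open>auto intro: integrable_abs\<close>)
  ultimately show "0 \<le> (\<integral>x. indicator ?E x * f x \<partial>completion \<mu>)"
    by (intro LIMSEQ_le_const) auto
qed

end

section \<open>Functions with a version for every measure\<close>

lemma Linf_of_real_iff: "(\<lambda>x. of_real (f x)) \<in> Linf \<longleftrightarrow> f \<in> univ_measurable"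
proof
  assume *: "(\<lambda>x. complex_of_real (f x)) \<in> Linf"
  then obtain B where B: "\<And>x. \<bar>f x\<bar> \<le> B"
    unfolding Linf_def bounded_iff by auto
  then show "f \<in> univ_measurable"
  proof (rule univ_measurableI)
    fix \<nu> :: "'a measure" assume \<nu>: "\<nu> \<in> prob_measures"
    then obtain g where g: "g \<in> borel_measurable borel" "AE x in \<nu>. g x = complex_of_real (f x)"
      using * unfolding Linf_def measurable_version_def by blast
    have "(\<lambda>x. Re (g x)) \<in> borel_measurable \<nu>"
      using g(1) by (simp add: borel_measurable_prob_measures[OF \<nu>])
    moreover have "AE x in \<nu>. f x = Re (g x)"
      using g(2) by eventually_elim simp
    ultimately show "f \<in> borel_measurable (completion \<nu>)"
      by (rule completion_measurable_AE)
  qed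
next
  assume f: "f \<in> univ_measurable"
  obtain B where "\<And>x. \<bar>f x\<bar> \<le> B"
    using f univ_measurable_bound by metis
  then have "bounded (range (\<lambda>x. complex_of_real (f x)))"
    by (auto intro!: boundedI[of _ B])
  moreover have "\<exists>g. measurable_version \<nu> (\<lambda>x. complex_of_real (f x)) g" if \<nu>: "\<nu> \<in> prob_measures" for \<nu>
  proof -
    obtain g where g: "g \<in> borel_measurable \<nu>" "AE x in \<nu>. f x = g x"
      using completion_ex_borel_measurable_real[OF univ_measurable_measurable[OF f \<nu>]] by blast
    from g(2) have "AE x in \<nu>. complex_of_real (g x) = of_real (f x)"
      by eventually_elim simp
    then show ?thesis
      using g(1) \<nu> by (intro exI[of _ "\<lambda>x. of_real (g x)"])
        (simp add: measurable_version_def borel_measurable_prob_measures)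
  qed
  ultimately show "(\<lambda>x. complex_of_real (f x)) \<in> Linf"
    by (simp add: Linf_def)
qed

lemma integral_Linf_of_real:
  assumes f: "f \<in> univ_measurable" and \<nu>: "\<nu> \<in> prob_measures"
  shows "integral_Linf \<nu> (\<lambda>x. of_real (f x)) = of_real (integral\<^sup>L (completion \<nu>) f)"
proof -
  define g where "g = (SOME g. measurable_version \<nu> (\<lambda>x. complex_of_real (f x)) g)"
  have "(\<lambda>x. complex_of_real (f x)) \<in> Linf"
    using f by (simp add: Linf_of_real_iff)
  then have "\<exists>g. measurable_version \<nu> (\<lambda>x. complex_of_real (f x)) g"
    using \<nu> by (simp add: Linf_def)
  then have "measurable_version \<nu> (\<lambda>x. complex_of_real (f x)) g"
    unfolding g_def by (rule someI_ex)
  then have g: "g \<in> borel_measurable \<nu>" "AE x in \<nu>. complex_of_real (f x) = g x"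
    by (auto simp: measurable_version_def borel_measurable_prob_measures[OF \<nu>] eq_commute)
  have "integral_Linf \<nu> (\<lambda>x. of_real (f x)) = integral\<^sup>L \<nu> g"
    by (simp add: integral_Linf_def g_def)
  also have "\<dots> = integral\<^sup>L (completion \<nu>) (\<lambda>x. complex_of_real (f x))"
    by (rule integral_completion_eq[OF g, symmetric])
  finally show ?thesis
    by simp
qed

lemma pos_set_iff: "x \<in> pos_set L \<phi> \<longleftrightarrow> (\<exists>k\<ge>1. 0 < Re (\<Sum>j<k. (ext_transfer L ^^ j) \<phi> x))"
proof -
  have "0 < max_partial_sum L \<phi> n x \<longleftrightarrow> (\<exists>k\<in>{1..n}. 0 < Re (\<Sum>j<k. (ext_transfer L ^^ j) \<phi> x))"
    if "1 \<le> n" for n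
    unfolding max_partial_sum_def using that by (subst Max_gr_iff) auto
  then have "x \<in> pos_set L \<phi> \<longleftrightarrow> (\<exists>n\<ge>1. \<exists>k\<in>{1..n}. 0 < Re (\<Sum>j<k. (ext_transfer L ^^ j) \<phi> x))"
    by (auto simp: pos_set_def less_SUP_iff)
  also have "\<dots> \<longleftrightarrow> (\<exists>k\<ge>1. 0 < Re (\<Sum>j<k. (ext_transfer L ^^ j) \<phi> x))"
    by (meson atLeastAtMost_iff order_refl)
  finally show ?thesis .
qed

theorem theorem1:
  fixes L :: "('a::metric_space \<Rightarrow> complex) \<Rightarrow> ('a \<Rightarrow> complex)"
    and \<mu> :: "'a measure"
    and \<phi> :: "'a \<Rightarrow> complex"
  assumes "compact (UNIV :: 'a set)"
    and "transfer_operator L"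
    and "\<mu> \<in> prob_measures"
    and "dual_transfer L \<mu> = \<mu>"
    and "\<phi> \<in> Linf"
    and "\<forall>x. \<phi> x \<in> \<real>"
  shows "set_integral_Linf \<mu> (pos_set L \<phi>) \<phi> \<in> \<real>\<^sub>\<ge>\<^sub>0"
proof -
  interpret markov_kernel "transition_prob L"
    by standard (rule measurable_transition_prob[OF assms(1,2)])
  note \<mu> = assms(3)
  have invariant: "\<mu> \<bind> transition_prob L = \<mu>"
    by (rule dual_transfer_fixpoint_bind[OF assms(1-4)])
  define f where "f x = Re (\<phi> x)" for x
  have \<phi>_eq: "\<phi> = (\<lambda>x. of_real (f x))"
    using assms(6) by (auto simp: f_def fun_eq_iff)
  have f: "f \<in> univ_measurable"
    using assms(5) unfolding \<phi>_eq by (simp add: Linf_of_real_iff)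
  have ext: "ext_transfer L (\<lambda>x. of_real (h x)) = (\<lambda>x. of_real (average h x))"
    if "h \<in> univ_measurable" for h
    unfolding ext_transfer_def average_def
    by (simp add: integral_Linf_of_real[OF that kernel_in_prob_measures])
  have iterate: "(ext_transfer L ^^ j) \<phi> = (\<lambda>x. of_real ((average ^^ j) f x))" for j
    by (induction j) (simp_all add: \<phi>_eq ext average_iterate_univ_measurable f)
  define E where "E = pos_set L \<phi>"
  have E: "E = {x. \<exists>k\<ge>1. 0 < partial_sum f k x}"
    by (auto simp: E_def pos_set_iff iterate partial_sum_def)
  have "set_integral_Linf \<mu> E \<phi> = integral_Linf \<mu> (\<lambda>x. of_real (indicator E x * f x))"
    by (simp add: set_integral_Linf_def \<phi>_eq of_real_indicator)
  also have "\<dots> = of_real (\<integral>x. indicator E x * f x \<partial>completion \<mu>)"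
    unfolding E by (intro integral_Linf_of_real univ_measurable_on_pos_partial_sum f \<mu>)
  finally have "set_integral_Linf \<mu> E \<phi> = of_real (\<integral>x. indicator E x * f x \<partial>completion \<mu>)" .
  moreover have "0 \<le> (\<integral>x. indicator E x * f x \<partial>completion \<mu>)"
    unfolding E by (rule maximal_ergodic_inequality[OF f \<mu> invariant])
  ultimately show ?thesis
    by (simp add: E_def)
qed

end
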